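(* Let $n\ge 1$ and let $A\subset \mathbb{R}^n_{\geq 0}$ be a moment region which is compact with star-shaped interior, and whose boundary intersects transversely the rays from the star-center. Assume moreover that $A$ satisfies the following criterion: for every $i\in\{1,\dots,n\}$, writing $P_i=\{(\rho_1,\dots,\rho_n)\in\mathbb{R}^n \mid \rho_i=0\}$, if $A\cap P_i\neq\emptyset$, then every line normal to $P_i$ has connected intersection with $A\cup P_i$. Then, for every symplectic capacity $c$ on subsets of $(\mathbb{C}^n,\omega_{\mathrm{std}})$, $$c\big(\mu^{-1}(A)\big)=c\big(\mu^{-1}(A+(1,1,\dots,1))\big).$$
   Context: $\omega_{\mathrm{std}}=\sum_{i=1}^n dx_i\wedge dy_i$ is the standard symplectic form on $\mathbb{C}^n$ (with $z_i=x_i+\sqrt{-1}\,y_i$). The moment map is $\mu:\mathbb{C}^n\to\mathbb{R}^n$, $\mu(z_1,\dots,z_n)=(\pi|z_1|^2,\dots,\pi|z_n|^2)$, with image $\mathbb{R}^n_{\ge 0}$. A toric domain is a set of the form $\mu^{-1}(A)$ with $A\subset\mathbb{R}^n_{\ge 0}$; $A$ is called its moment region. $A+v$ denotes the translate $\{x+v: x\in A\}$. A symplectic capacity is an assignment $c$ of an element $c(U)\in[0,\infty]$ to each subset $U\subset(\mathbb{C}^n,\omega_{\mathrm{std}})$ such that: (C1, monotonicity) $c(U)\le c(V)$ whenever there is a symplectic embedding $U\hookrightarrow V$; (C2, conformality) $c(\lambda U)=\lambda^2c(U)$ for $\lambda\in\mathbb{R}$; (C3, nontriviality) $0<c(B^{2n}(1))<\infty$,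 where $B^{2n}(1)=\{z\in\mathbb{C}^n : \pi|z|^2\le 1\}$. A symplectic embedding $U\hookrightarrow V$ of subsets of $\mathbb{C}^n$ is a map $U\to V$ that is the restriction of a smooth embedding $\varphi$ of an open neighborhood of $U$ into $\mathbb{C}^n$ with $\varphi^*\omega_{\mathrm{std}}=\omega_{\mathrm{std}}$. Interior and boundary of $A$ are taken in $\mathbb{R}^n$. The interior of $A$ is star-shaped if there is a star-center $p\in\operatorname{int}A$, meaning that every point of $\operatorname{int}A$ can be joined to $p$ by a line segment contained in $\operatorname{int}A$; the transversality hypothesis refers to the rays emanating from such a $p$. The boundary $\partial A$ is a hypersurface, or, if not completely smooth, a gluing of several smooth hypersurfaces; in the latter case transversality means that the rays from $p$ are transverse to each of these hypersurfaces, including at the points where they are glued together. *)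

theory Defs
  imports "HOL-Analysis.Analysis"
begin

text \<open>
  In finite dimensions, a map is \<open>C\<^sup>k\<^sup>+\<^sup>1\<close> on an open set iff it is differentiable there and
  all its directional derivatives are \<open>C\<^sup>k\<close>.  The definitions are only meant for open sets.
\<close>

primrec Ck_on :: "nat \<Rightarrow> 'a::real_normed_vector set \<Rightarrow> ('a \<Rightarrow> 'b::real_normed_vector) \<Rightarrow> bool" where
  "Ck_on 0 W f \<longleftrightarrow> continuous_on W f"
| "Ck_on (Suc k) W f \<longleftrightarrow>
     (\<forall>x\<in>W. f differentiable (at x)) \<and>
     (\<forall>v. Ck_on k W (\<lambda>x. frechet_derivative f (at x) v))"

definition smooth_on :: "'a::real_normed_vector set \<Rightarrow> ('a \<Rightarrow> 'b::real_normed_vector) \<Rightarrow> bool" where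
  "smooth_on W f \<longleftrightarrow> (\<forall>k. Ck_on k W f)"

definition smooth_embedding_on ::
  "'a::real_normed_vector set \<Rightarrow> ('a \<Rightarrow> 'b::real_normed_vector) \<Rightarrow> bool" where
  "smooth_embedding_on W f \<longleftrightarrow>
     smooth_on W f \<and>
     (\<forall>x\<in>W. inj (frechet_derivative f (at x))) \<and>
     (\<exists>g. homeomorphism W (f ` W) f g)"

definition omega_std :: "complex^'n \<Rightarrow> complex^'n \<Rightarrow> real" where
  "omega_std u v = (\<Sum>i\<in>UNIV. Re (u $ i) * Im (v $ i) - Im (u $ i) * Re (v $ i))"

definition symplectically_embeds :: "(complex^'n) set \<Rightarrow> (complex^'n) set \<Rightarrow> bool" where
  "symplectically_embeds U V \<longleftrightarrow>
     (\<exists>W \<phi>. open W \<and> U \<subseteq> W \<and> smooth_embedding_on W \<phi> \<and>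
        (\<forall>x\<in>W. \<forall>u v. omega_std (frechet_derivative \<phi> (at x) u) (frechet_derivative \<phi> (at x) v)
                     = omega_std u v) \<and>
        \<phi> ` U \<subseteq> V)"

definition symplectic_capacity :: "((complex^'n) set \<Rightarrow> ennreal) \<Rightarrow> bool" where
  "symplectic_capacity c \<longleftrightarrow>
     (\<forall>U V. symplectically_embeds U V \<longrightarrow> c U \<le> c V) \<and>
     (\<forall>(r::real) U. c ((\<lambda>z. r *\<^sub>R z) ` U) = ennreal (r\<^sup>2) * c U) \<and>
     0 < c {z. pi * (norm z)\<^sup>2 \<le> 1} \<and> c {z. pi * (norm z)\<^sup>2 \<le> 1} < \<infinity>"

definition moment_map :: "complex^'n \<Rightarrow> real^'n" where
  "moment_map z = (\<chi> i. pi * (cmod (z $ i))\<^sup>2)"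

definition toric_domain :: "(real^'n) set \<Rightarrow> (complex^'n) set" where
  "toric_domain A = moment_map -` A"

definition coord_hyperplane :: "'n \<Rightarrow> (real^'n) set" where
  "coord_hyperplane i = {x. x $ i = 0}"

definition normal_line :: "'n \<Rightarrow> real^'n \<Rightarrow> (real^'n) set" where
  "normal_line i q = range (\<lambda>t. q + t *\<^sub>R axis i 1)"

definition star_center :: "'a::real_vector set \<Rightarrow> 'a \<Rightarrow> bool" where
  "star_center S p \<longleftrightarrow> p \<in> S \<and> (\<forall>x\<in>S. closed_segment p x \<subseteq> S)"

definition smooth_hypersurface :: "'a::euclidean_space set \<Rightarrow> bool" where
  "smooth_hypersurface S \<longleftrightarrow>
     (\<forall>x\<in>S. \<exists>W (g :: 'a \<Rightarrow> real). open W \<and> x \<in> W \<and> smooth_on W g \<and>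
        (\<forall>y\<in>W. \<exists>v. frechet_derivative g (at y) v \<noteq> 0) \<and>
        S \<inter> W = {y\<in>W. g y = 0})"

definition tangent_space :: "'a::euclidean_space set \<Rightarrow> 'a \<Rightarrow> 'a set" where
  "tangent_space S x =
     {v. \<exists>\<epsilon>>0. \<exists>\<gamma>. smooth_on {-\<epsilon><..<\<epsilon>} \<gamma> \<and> \<gamma> ` {-\<epsilon><..<\<epsilon>} \<subseteq> S \<and> \<gamma> 0 = x \<and>
           (\<gamma> has_vector_derivative v) (at (0::real))}"

definition topological_hypersurface :: "'a::euclidean_space set \<Rightarrow> bool" where
  "topological_hypersurface M \<longleftrightarrow>
     (\<forall>x\<in>M. \<exists>U (L :: 'a set) V. x \<in> U \<and> openin (top_of_set M) U \<and>
        subspace L \<and> dim L = DIM('a) - 1 \<and> openin (top_of_set L) V \<and> U homeomorphic V)"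

text \<open>
  A hypersurface \<open>M\<close> (without boundary) obtained by gluing finitely many smooth pieces.  Each pair
  \<open>(S, F)\<close> consists of a piece \<open>F\<close>, smooth up to its boundary, and a smooth hypersurface \<open>S\<close> without
  boundary that extends it.  As \<open>F\<close> is the closure of its interior relative to \<open>S\<close>, the tangent
  space of \<open>S\<close> is determined by \<open>F\<close> also at the points of \<open>F\<close> where pieces are glued together.
  The case where \<open>M\<close> itself is smooth and closed is the one with the single pair \<open>(M, M)\<close>.
\<close>

definition hypersurface_gluing ::
  "('a::euclidean_space set \<times> 'a set) set \<Rightarrow> 'a set \<Rightarrow> bool" where
  "hypersurface_gluing H M \<longleftrightarrow>
     topological_hypersurface M \<and> finite H \<and> M = (\<Union>(S, F)\<in>H. F) \<and>
     (\<forall>(S, F)\<in>H. smooth_hypersurface S \<and> F \<subseteq> S \<and>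
        F = closure ((top_of_set S) interior_of F))"

definition ray_transverse :: "'a::euclidean_space \<Rightarrow> 'a set \<Rightarrow> 'a \<Rightarrow> bool" where
  "ray_transverse p S x \<longleftrightarrow> span (insert (x - p) (tangent_space S x)) = UNIV"

end

theory Submission
  imports Defs
begin

text \<open>
  Over the open orthant a moment region may be translated freely: in each factor
  \<open>\<complex> - {0}\<close> the map \<open>radial_shift v\<close>, which changes \<open>\<rho> = \<pi>|z|\<^sup>2\<close> into \<open>\<rho> + v\<close> and keeps the
  angle, is symplectic.  Together with conformality this gives, for \<open>l > 0\<close> and
  \<open>A\<^sub>l = p + l (A - p)\<close>, that every translate of \<open>A\<^sub>l\<close> in the open orthant has capacity
  \<open>l c(A + 1)\<close>, where \<open>c\<close> of a region means \<open>c\<close> of its toric domain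
  (\<open>capacity_toric_dilation\<close>).  So it suffices to compare \<open>A\<close> with dilations of itself
  and to let \<open>l\<close> tend to 1.

  If \<open>A\<close> meets no coordinate hyperplane, one translation in each direction finishes the
  proof.  Otherwise, the criterion says that \<open>A\<close> is closed under lowering the \<open>i\<close>-th coordinate
  (\<open>lowerable\<close>) for each \<open>i\<close> in the set \<open>I\<close> of those directions whose hyperplane \<open>A\<close> meets.
  Transversality forbids a radial segment in the boundary, and hence \<open>A\<^sub>l\<close> lies in the interior of
  \<open>A\<close> for \<open>l < 1\<close>, as soon as \<open>A\<close> is the closure of its interior.  The latter is a consequence of
  lowerability in one direction and of the boundary being a topological hypersurface
  (\<open>lowerable_eq_closure_interior\<close>, by invariance of domain); without lowerability it
  fails, since the boundary may then have components apart from the interior.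

  For \<open>l < 1\<close>, the set \<open>A\<^sub>l\<close> lies in the interior of \<open>A\<close>, thus \<open>l c(A + 1) = c(A\<^sub>l) \<le> c(A)\<close>.  For the
  other inequality, the toric domain of \<open>A\<close> has to be moved off the coordinate planes
  \<open>z\<^sub>i = 0\<close> with \<open>i \<in> I\<close>, at the cost of an arbitrarily small increase of each \<open>\<rho>\<^sub>i\<close>; lowerability then
  places the image in \<open>A\<^sub>l\<close> for a given \<open>l > 1\<close>, and a translation by \<open>(1,\<dots>,1)\<close> gives
  \<open>c(A) \<le> c(A\<^sub>l + 1) = l c(A + 1)\<close>.

  The planar map used for this purpose is the heart of the proof.  It is an explicit area
  preserving embedding \<open>\<psi>\<close> of the plane such that \<open>\<psi>\<close> does not vanish on a given disc and
  \<open>|\<psi>(z)|\<^sup>2 \<le> |z|\<^sup>2 + \<epsilon>\<close> there, for all radii at once.  It pulls a point outside the disc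
  into the origin along a finger so thin that the area displaced by it is
  negligible, and spreads this area in a fan on the opposite side (\<open>finger_move\<close>).
\<close>

section \<open>Closure properties of smooth maps\<close>

text \<open>
  The predicate only looks at the map on the open set, because its derivatives there are local.
\<close>

lemma Ck_on_cong:
  assumes "open W" "\<And>x. x \<in> W \<Longrightarrow> f x = g x"
  shows "Ck_on k W f \<longleftrightarrow> Ck_on k W g"
  using assms(2)
proof (induction k arbitrary: f g)
  case 0
  then show ?case by (simp cong: continuous_on_cong)
next
  case (Suc k)
  have hd: "(f has_derivative D) (at x) \<longleftrightarrow> (g has_derivative D) (at x)" if "x \<in> W" for x D
    using has_derivative_transform_within_open[OF _ assms(1) that] Suc.prems by metis
  have 1: "f differentiable at x \<longleftrightarrow> g differentiable at x" if "x \<in> W" for x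
    using hd[OF that] by (simp add: differentiable_def)
  have 2: "frechet_derivative f (at x) = frechet_derivative g (at x)" if "x \<in> W" for x
    using hd[OF that] by (simp add: frechet_derivative_def)
  have "Ck_on k W (\<lambda>x. frechet_derivative f (at x) v) = Ck_on k W (\<lambda>x. frechet_derivative g (at x) v)" for v
    by (rule Suc.IH) (simp add: 2)
  then show ?case using 1 by auto
qed

text \<open>
  The derivative may be given by any explicit formula; this avoids computing with
  \<open>frechet_derivative\<close>.
\<close>

lemma Ck_on_SucI:
  assumes "open W" "\<And>x. x \<in> W \<Longrightarrow> (f has_derivative f' x) (at x)"
    and "\<And>v. Ck_on k W (\<lambda>x. f' x v)"
  shows "Ck_on (Suc k) W f"
proof -
  have "Ck_on k W (\<lambda>x. frechet_derivative f (at x) v) \<longleftrightarrow> Ck_on k W (\<lambda>x. f' x v)" for v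
    by (rule Ck_on_cong[OF assms(1)]) (metis assms(2) frechet_derivative_at)
  then show ?thesis using assms by (auto simp: differentiable_def)
qed

lemma Ck_on_SucD:
  assumes "Ck_on (Suc k) W f" "x \<in> W"
  shows "(f has_derivative frechet_derivative f (at x)) (at x)"
  using assms by (simp add: frechet_derivative_works)

lemma Ck_on_Suc_imp: "Ck_on (Suc k) W f \<Longrightarrow> Ck_on k W f"
proof (induction k arbitrary: f)
  case 0
  then show ?case by (auto intro!: continuous_at_imp_continuous_on differentiable_imp_continuous_within)
next
  case (Suc k)
  have "Ck_on k W (\<lambda>x. frechet_derivative f (at x) v)" for v
    using Suc.prems by (intro Suc.IH) simp
  with Suc.prems show ?case by simp
qed

lemma Ck_on_const: "open W \<Longrightarrow> Ck_on k W (\<lambda>x. a)"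
proof (induction k arbitrary: a)
  case (Suc k)
  show ?case by (rule Ck_on_SucI[OF \<open>open W\<close>, where f' = "\<lambda>x v. 0"]) (auto intro!: Suc)
qed simp

lemma Ck_on_bounded_linear:
  assumes "open W" "bounded_linear L"
  shows "Ck_on k W L"
proof (cases k)
  case 0
  then show ?thesis using assms by (simp add: linear_continuous_on)
next
  case (Suc j)
  then show ?thesis
    using Ck_on_SucI[OF assms(1), where f = L and f' = "\<lambda>x. L"] Ck_on_const[OF assms(1)]
      bounded_linear_imp_has_derivative[OF assms(2)] by blast
qed

lemma Ck_on_add:
  assumes "open W"
  shows "Ck_on k W f \<Longrightarrow> Ck_on k W g \<Longrightarrow> Ck_on k W (\<lambda>x. f x + g x)"
proof (induction k arbitrary: f g)
  case 0
  then show ?case by (simp add: continuous_on_add)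
next
  case (Suc k)
  have "Ck_on k W (\<lambda>x. frechet_derivative f (at x) v)"
    "Ck_on k W (\<lambda>x. frechet_derivative g (at x) v)" for v
    using Suc.prems by simp_all
  then show ?case
    by (intro Ck_on_SucI[OF assms has_derivative_add[OF Ck_on_SucD[OF Suc.prems(1)] Ck_on_SucD[OF Suc.prems(2)]]]
        Suc.IH)
qed

lemma Ck_on_bilinear:
  assumes "open W" and B: "bounded_bilinear B"
  shows "Ck_on k W f \<Longrightarrow> Ck_on k W g \<Longrightarrow> Ck_on k W (\<lambda>x. B (f x) (g x))"
proof (induction k arbitrary: f g)
  case 0
  then show ?case using bounded_bilinear.continuous_on[OF B] by auto
next
  case (Suc k)
  have fg: "Ck_on k W f" "Ck_on k W g" using Suc.prems Ck_on_Suc_imp by blast+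
  have "Ck_on k W (\<lambda>x. frechet_derivative f (at x) v)"
    "Ck_on k W (\<lambda>x. frechet_derivative g (at x) v)" for v
    using Suc.prems by simp_all
  with fg show ?case
    by (intro Ck_on_SucI[OF assms(1) bounded_bilinear.FDERIV[OF B Ck_on_SucD[OF Suc.prems(1)]
            Ck_on_SucD[OF Suc.prems(2)]]] Ck_on_add assms(1) Suc.IH)
qed

lemma Ck_on_sum:
  assumes "open W" "\<And>i. i \<in> I \<Longrightarrow> Ck_on k W (f i)"
  shows "Ck_on k W (\<lambda>x. \<Sum>i\<in>I. f i x)"
  using assms(2)
  by (induction I rule: infinite_finite_induct)
    (auto intro!: Ck_on_const Ck_on_add assms(1))

lemma Ck_on_compose:
  fixes f :: "'a::real_normed_vector \<Rightarrow> 'b::euclidean_space" and g :: "'b \<Rightarrow> 'c::real_normed_vector"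
  assumes "open W" "open V" "f ` W \<subseteq> V"
  shows "Ck_on k W f \<Longrightarrow> Ck_on k V g \<Longrightarrow> Ck_on k W (\<lambda>x. g (f x))"
proof (induction k arbitrary: g)
  case 0
  then show ?case using continuous_on_compose2[OF _ _ assms(3)] by simp
next
  case (Suc k)
  have fk: "Ck_on k W f" using Suc.prems Ck_on_Suc_imp by blast
  \<comment> \<open>expanding the inner derivative in a basis turns the chain rule into a finite sum of
      products, to which the induction hypothesis applies\<close>
  let ?D = "\<lambda>x v. \<Sum>b\<in>Basis. (frechet_derivative f (at x) v \<bullet> b) *\<^sub>R frechet_derivative g (at (f x)) b"
  have "((\<lambda>x. g (f x)) has_derivative ?D x) (at x)" if "x \<in> W" for x
  proof -
    have g: "(g has_derivative frechet_derivative g (at (f x))) (at (f x))"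
      using Ck_on_SucD[OF Suc.prems(2)] assms(3) that by blast
    interpret bounded_linear "frechet_derivative g (at (f x))" using g by (rule has_derivative_bounded_linear)
    have "frechet_derivative g (at (f x)) (frechet_derivative f (at x) v) = ?D x v" for v
      by (subst euclidean_representation[of "frechet_derivative f (at x) v", symmetric])
        (simp only: sum scaleR)
    then show ?thesis
      using has_derivative_compose[OF Ck_on_SucD[OF Suc.prems(1) that] g] by simp
  qed
  moreover have "Ck_on k W (\<lambda>x. ?D x v)" for v
  proof (intro Ck_on_sum assms(1) Ck_on_bilinear[OF assms(1) bounded_bilinear_scaleR])
    fix b :: 'b
    show "Ck_on k W (\<lambda>x. frechet_derivative f (at x) v \<bullet> b)"
      using Suc.prems(1) by (intro Ck_on_bilinear[OF assms(1) bounded_bilinear_inner] Ck_on_const assms(1)) simp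
    show "Ck_on k W (\<lambda>x. frechet_derivative g (at (f x)) b)"
      using Suc.prems(2) by (intro Suc.IH fk) simp
  qed
  ultimately show ?case by (rule Ck_on_SucI[OF assms(1)])
qed

lemma smooth_on_const: "open W \<Longrightarrow> smooth_on W (\<lambda>x. a)"
  by (simp add: smooth_on_def Ck_on_const)

lemma smooth_on_bounded_linear: "open W \<Longrightarrow> bounded_linear L \<Longrightarrow> smooth_on W L"
  by (simp add: smooth_on_def Ck_on_bounded_linear)

lemma smooth_on_add: "open W \<Longrightarrow> smooth_on W f \<Longrightarrow> smooth_on W g \<Longrightarrow> smooth_on W (\<lambda>x. f x + g x)"
  by (simp add: smooth_on_def Ck_on_add)

lemma smooth_on_sum:
  "open W \<Longrightarrow> (\<And>i. i \<in> I \<Longrightarrow> smooth_on W (f i)) \<Longrightarrow> smooth_on W (\<lambda>x. \<Sum>i\<in>I. f i x)"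
  by (simp add: smooth_on_def Ck_on_sum)

lemma smooth_on_scaleR:
  "open W \<Longrightarrow> smooth_on W f \<Longrightarrow> smooth_on W g \<Longrightarrow> smooth_on W (\<lambda>x. f x *\<^sub>R g x)"
  by (simp add: smooth_on_def Ck_on_bilinear bounded_bilinear_scaleR)

lemma smooth_on_mult:
  fixes f g :: "'a::real_normed_vector \<Rightarrow> real"
  shows "open W \<Longrightarrow> smooth_on W f \<Longrightarrow> smooth_on W g \<Longrightarrow> smooth_on W (\<lambda>x. f x * g x)"
  using smooth_on_scaleR[of W f g] by simp

lemma smooth_on_compose:
  fixes f :: "'a::real_normed_vector \<Rightarrow> 'b::euclidean_space" and g :: "'b \<Rightarrow> 'c::real_normed_vector"
  assumes "open W" "open V" "f ` W \<subseteq> V" "smooth_on W f" "smooth_on V g"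
  shows "smooth_on W (\<lambda>x. g (f x))"
  unfolding smooth_on_def
proof
  show "Ck_on k W (\<lambda>x. g (f x))" for k
    by (rule Ck_on_compose[OF assms(1-3)]) (use assms(4,5) in \<open>simp_all add: smooth_on_def\<close>)
qed

lemma smooth_on_differentiable: "smooth_on W f \<Longrightarrow> x \<in> W \<Longrightarrow> f differentiable (at x)"
  using Ck_on.simps(2)[of 0 W f] unfolding smooth_on_def by metis

lemma smooth_on_imp_continuous_on: "smooth_on W f \<Longrightarrow> continuous_on W f"
  using Ck_on.simps(1)[of W f] unfolding smooth_on_def by metis

lemma Ck_on_mult_const:
  fixes f :: "'a::real_normed_vector \<Rightarrow> real"
  assumes "open W" "Ck_on k W f"
  shows "Ck_on k W (\<lambda>x. f x * a)"
  by (rule Ck_on_bilinear[OF assms(1) bounded_bilinear_mult assms(2) Ck_on_const[OF assms(1)]])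

lemma smooth_on_exp: "smooth_on UNIV (exp :: real \<Rightarrow> real)"
proof -
  have "Ck_on k UNIV (exp :: real \<Rightarrow> real)" for k
  proof (induction k)
    case 0
    then show ?case by (auto intro!: continuous_intros)
  next
    case (Suc k)
    show ?case
      by (rule Ck_on_SucI[where f' = "\<lambda>x v. exp x * v"])
        (use DERIV_exp Ck_on_mult_const[OF open_UNIV Suc] in \<open>simp_all add: has_field_derivative_def\<close>)
  qed
  then show ?thesis by (simp add: smooth_on_def)
qed

lemma smooth_on_inverse: "smooth_on {0<..} (inverse :: real \<Rightarrow> real)"
proof -
  have "Ck_on k {0<..} (inverse :: real \<Rightarrow> real)" for k
  proof (induction k)
    case 0
    then show ?case by (auto intro!: continuous_intros)
  next
    case (Suc k)
    have C: "Ck_on k {0<..} (\<lambda>x. (inverse x * inverse x) * (- v))" for v :: real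
      by (rule Ck_on_mult_const[OF open_greaterThan
            Ck_on_bilinear[OF open_greaterThan bounded_bilinear_mult Suc Suc]])
    have D: "(inverse has_derivative (\<lambda>v. (inverse x * inverse x) * (- v))) (at x)"
      if "x \<in> {0<..}" for x :: real
      by (rule has_derivative_eq_rhs[OF DERIV_inverse[of x, unfolded has_field_derivative_def]])
        (use that in \<open>auto simp: mult.assoc\<close>)
    show ?case by (rule Ck_on_SucI[OF open_greaterThan D C])
  qed
  then show ?thesis by (simp add: smooth_on_def)
qed

lemma smooth_on_ln: "smooth_on {0<..} (ln :: real \<Rightarrow> real)"
proof -
  have "Ck_on (Suc k) {0<..} (ln :: real \<Rightarrow> real)" for k
  proof (rule Ck_on_SucI[OF open_greaterThan])
    show "(ln has_derivative (\<lambda>v. inverse x * v)) (at x)" if "x \<in> {0<..}" for x :: real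
      using DERIV_ln[of x] that by (simp add: has_field_derivative_def)
    show "Ck_on k {0<..} (\<lambda>x. inverse x * v)" for v :: real
      using smooth_on_inverse Ck_on_mult_const[OF open_greaterThan] unfolding smooth_on_def by blast
  qed
  then show ?thesis using Ck_on_Suc_imp unfolding smooth_on_def by blast
qed

lemma smooth_on_exp_compose:
  fixes f :: "'a::real_normed_vector \<Rightarrow> real"
  assumes "open W" "smooth_on W f"
  shows "smooth_on W (\<lambda>x. exp (f x))"
  by (rule smooth_on_compose[OF assms(1) open_UNIV _ assms(2) smooth_on_exp]) simp

lemma smooth_on_inverse_compose:
  fixes f :: "'a::real_normed_vector \<Rightarrow> real"
  assumes "open W" "smooth_on W f" "\<And>x. x \<in> W \<Longrightarrow> f x > 0"
  shows "smooth_on W (\<lambda>x. inverse (f x))"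
  by (rule smooth_on_compose[OF assms(1) open_greaterThan _ assms(2) smooth_on_inverse])
    (use assms(3) in auto)

lemma smooth_on_ln_compose:
  fixes f :: "'a::real_normed_vector \<Rightarrow> real"
  assumes "open W" "smooth_on W f" "\<And>x. x \<in> W \<Longrightarrow> f x > 0"
  shows "smooth_on W (\<lambda>x. ln (f x))"
  by (rule smooth_on_compose[OF assms(1) open_greaterThan _ assms(2) smooth_on_ln])
    (use assms(3) in auto)

text \<open>
  The square root is reduced to \<open>exp\<close> and \<open>ln\<close>.
\<close>

lemma smooth_on_sqrt_compose:
  fixes f :: "'a::real_normed_vector \<Rightarrow> real"
  assumes "open W" "smooth_on W f" "\<And>x. x \<in> W \<Longrightarrow> f x > 0"
  shows "smooth_on W (\<lambda>x. sqrt (f x))"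
proof -
  have "smooth_on W (\<lambda>x. exp ((1/2) * ln (f x)))"
    by (rule smooth_on_exp_compose[OF assms(1)], rule smooth_on_mult[OF assms(1)],
        rule smooth_on_const[OF assms(1)], rule smooth_on_ln_compose[OF assms])
  moreover have "exp ((1/2) * ln (f x)) = sqrt (f x)" if "x \<in> W" for x
  proof -
    have "(1/2) * ln (f x) = ln (sqrt (f x))"
      using ln_sqrt[of "f x"] assms(3)[OF that] by simp
    then show ?thesis using assms(3)[OF that] by (simp only: exp_ln real_sqrt_gt_zero)
  qed
  ultimately have "Ck_on k W (\<lambda>x. sqrt (f x))" for k
    using Ck_on_cong[OF assms(1), of "\<lambda>x. exp ((1/2) * ln (f x))" "\<lambda>x. sqrt (f x)" k]
    by (simp add: smooth_on_def)
  then show ?thesis by (simp add: smooth_on_def)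
qed

section \<open>Products of planar area preserving embeddings\<close>

text \<open>
  The planar case of a symplectic embedding of an open set.  Preservation of area makes the
  derivative injective.
\<close>

definition area_preserving_embedding :: "complex set \<Rightarrow> (complex \<Rightarrow> complex) \<Rightarrow> bool" where
  "area_preserving_embedding Q f \<longleftrightarrow>
     open Q \<and> smooth_on Q f \<and>
     (\<forall>z\<in>Q. \<exists>D. (f has_derivative D) (at z) \<and>
        (\<forall>u v. Re (D u) * Im (D v) - Im (D u) * Re (D v) = Re u * Im v - Im u * Re v)) \<and>
     (\<exists>g. continuous_on (f ` Q) g \<and> (\<forall>z\<in>Q. g (f z) = z))"

lemma omega_std_nondegenerate:
  assumes "\<And>v. omega_std u v = 0"
  shows "u = 0"
proof -
  have "omega_std u (\<chi> i. \<i> * u $ i) = (\<Sum>i\<in>UNIV. (cmod (u $ i))\<^sup>2)"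
    unfolding omega_std_def by (intro sum.cong) (unfold cmod_power2, simp_all add: power2_eq_square)
  then have "(\<Sum>i\<in>UNIV. (cmod (u $ i))\<^sup>2) = 0" using assms by simp
  then show ?thesis by (simp add: sum_nonneg_eq_0_iff vec_eq_iff)
qed

lemma bounded_linear_axis: "bounded_linear (axis i :: 'a::euclidean_space \<Rightarrow> 'a ^ 'n)"
  by (intro linear_conv_bounded_linear[THEN iffD1] linearI) (auto simp: axis_def vec_eq_iff)

lemma vec_lambda_eq_sum_axis: "(\<chi> i. x i) = (\<Sum>i\<in>UNIV. axis i (x i :: 'a::comm_monoid_add))"
  by (simp add: vec_eq_iff axis_def sum_component if_distrib[of "\<lambda>t. t $ _"] cong: if_cong)

text \<open>
  The form \<open>omega_std\<close> is the sum of the area forms of the factors, so a map acting separately on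
  each coordinate is symplectic if each component preserves area; its derivative is then injective
  because \<open>omega_std\<close> is nondegenerate.
\<close>

lemma symplectically_embeds_product:
  fixes f :: "'n::finite \<Rightarrow> complex \<Rightarrow> complex"
  assumes emb: "\<And>i. area_preserving_embedding (Q i) (f i)"
    and U: "\<And>z i. z \<in> U \<Longrightarrow> z $ i \<in> Q i"
    and V: "\<And>z. z \<in> U \<Longrightarrow> (\<chi> i. f i (z $ i)) \<in> V"
  shows "symplectically_embeds U V"
proof -
  define W where "W = {z :: complex ^ 'n. \<forall>i. z $ i \<in> Q i}"
  define F where "F = (\<lambda>z :: complex ^ 'n. \<chi> i. f i (z $ i))"
  have Q: "open (Q i)" "smooth_on (Q i) (f i)" for i
    using emb by (simp_all add: area_preserving_embedding_def)
  have W: "open W"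
  proof -
    have "W = (\<Inter>i. (\<lambda>z. z $ i) -` Q i)" by (auto simp: W_def)
    then show ?thesis using Q(1) by (auto intro!: open_INT continuous_open_vimage continuous_intros)
  qed
  obtain D where D: "\<And>i z. z \<in> Q i \<Longrightarrow> (f i has_derivative D i z) (at z)"
    and area: "\<And>i z u v. z \<in> Q i \<Longrightarrow>
      Re (D i z u) * Im (D i z v) - Im (D i z u) * Re (D i z v) = Re u * Im v - Im u * Re v"
    using emb unfolding area_preserving_embedding_def by metis
  obtain g where g: "\<And>i. continuous_on (f i ` Q i) (g i)" "\<And>i z. z \<in> Q i \<Longrightarrow> g i (f i z) = z"
    using emb unfolding area_preserving_embedding_def by metis
  have smooth: "smooth_on W F"
    unfolding F_def vec_lambda_eq_sum_axis
  proof (rule smooth_on_sum[OF W])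
    fix i :: 'n
    have "smooth_on W (\<lambda>z. f i (z $ i))"
      by (rule smooth_on_compose[OF W Q(1) _ smooth_on_bounded_linear[OF W bounded_linear_vec_nth] Q(2)])
        (auto simp: W_def)
    then show "smooth_on W (\<lambda>z. axis i (f i (z $ i)))"
      by (rule smooth_on_compose[OF W open_UNIV subset_UNIV _
            smooth_on_bounded_linear[OF open_UNIV bounded_linear_axis]])
  qed
  have der: "(F has_derivative (\<lambda>u. \<chi> i. D i (z $ i) (u $ i))) (at z)" if "z \<in> W" for z
    unfolding F_def vec_lambda_eq_sum_axis
  proof (rule has_derivative_sum)
    fix i :: 'n
    have "(f i has_derivative D i (z $ i)) (at (z $ i))" using D that by (simp add: W_def)
    then have "((\<lambda>z. f i (z $ i)) has_derivative (\<lambda>u. D i (z $ i) (u $ i))) (at z)"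
      by (rule has_derivative_compose[OF bounded_linear_imp_has_derivative[OF bounded_linear_vec_nth]])
    then show "((\<lambda>z. axis i (f i (z $ i))) has_derivative (\<lambda>u. axis i (D i (z $ i) (u $ i)))) (at z)"
      by (rule bounded_linear.has_derivative[OF bounded_linear_axis])
  qed
  have fd: "frechet_derivative F (at z) = (\<lambda>u. \<chi> i. D i (z $ i) (u $ i))" if "z \<in> W" for z
    using frechet_derivative_at[OF der[OF that]] by simp
  have sympl: "omega_std (frechet_derivative F (at z) u) (frechet_derivative F (at z) v) = omega_std u v"
    if "z \<in> W" for z u v
    unfolding fd[OF that] omega_std_def using that by (simp add: area W_def)
  have inj: "inj (frechet_derivative F (at z))" if "z \<in> W" for z
  proof -
    have lin: "linear (frechet_derivative F (at z))"
      using der[OF that] by (simp add: fd[OF that] has_derivative_linear)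
    show ?thesis
      unfolding linear_injective_0[OF lin]
    proof (intro allI impI)
      fix u assume "frechet_derivative F (at z) u = 0"
      then have "omega_std u v = 0" for v
        using sympl[OF that, of u v] by (simp add: omega_std_def)
      then show "u = 0" by (rule omega_std_nondegenerate)
    qed
  qed
  have "homeomorphism W (F ` W) F (\<lambda>w. \<chi> i. g i (w $ i))"
  proof (rule homeomorphismI)
    show "continuous_on W F" using smooth by (rule smooth_on_imp_continuous_on)
    show "continuous_on (F ` W) (\<lambda>w. \<chi> i. g i (w $ i))"
    proof (rule continuous_on_vec_lambda)
      show "continuous_on (F ` W) (\<lambda>w. g i (w $ i))" for i
        by (rule continuous_on_compose2[OF g(1)[of i] continuous_on_component[OF continuous_on_id]])
          (auto simp: F_def W_def)
    qed
    have "(\<chi> i. g i (F z $ i)) = z" if "z \<in> W" for z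
      using that by (simp add: F_def W_def g(2) vec_eq_iff)
    then show "(\<lambda>w. \<chi> i. g i (w $ i)) ` F ` W \<subseteq> W"
      "\<And>z. z \<in> W \<Longrightarrow> (\<chi> i. g i (F z $ i)) = z"
      "\<And>w. w \<in> F ` W \<Longrightarrow> F (\<chi> i. g i (w $ i)) = w" by auto
  qed simp
  then have "smooth_embedding_on W F"
    using smooth inj by (auto simp: smooth_embedding_on_def)
  then show ?thesis
    unfolding symplectically_embeds_def
  proof (intro exI[of _ W] exI[of _ F] conjI ballI allI)
    show "U \<subseteq> W" using U by (simp add: W_def subset_iff)
    show "F ` U \<subseteq> V" unfolding F_def image_subset_iff using V by (intro ballI)
  qed (use W sympl in simp_all)
qed

section \<open>The radial shift\<close>

text \<open>
  In the coordinates \<open>\<rho> = \<pi>|z|\<^sup>2\<close> and \<open>\<theta> = arg z\<close>, in which the area form is \<open>d\<rho> \<and> d\<theta> / 2\<pi>\<close>, this is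
  the translation \<open>(\<rho>, \<theta>) \<mapsto> (\<rho> + v, \<theta>)\<close>.  Writing \<open>|z|\<^sup>2\<close> by real and imaginary parts
  exhibits the map as built from smooth functions.
\<close>

definition radial_shift :: "real \<Rightarrow> complex \<Rightarrow> complex" where
  "radial_shift v z = sqrt (1 + v * inverse (pi * ((Re z)\<^sup>2 + (Im z)\<^sup>2))) *\<^sub>R z"

lemma radial_shift_eq:
  "radial_shift v z = sqrt (1 + v * inverse (pi * (cmod z)\<^sup>2)) *\<^sub>R z"
  by (simp add: radial_shift_def cmod_power2)

lemma radial_shift_area:
  assumes "z \<noteq> 0" "0 < pi * (cmod z)\<^sup>2 + v"
  shows "pi * (cmod (radial_shift v z))\<^sup>2 = pi * (cmod z)\<^sup>2 + v"
proof -
  have z: "0 < (cmod z)\<^sup>2" using assms by simp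
  then have "1 + v * inverse (pi * (cmod z)\<^sup>2) = (pi * (cmod z)\<^sup>2 + v) / (pi * (cmod z)\<^sup>2)"
    by (simp add: field_simps)
  then have "0 \<le> 1 + v * inverse (pi * (cmod z)\<^sup>2)"
    using z assms(2) by simp
  then show ?thesis
    using z by (simp add: radial_shift_def power_mult_distrib flip: cmod_power2) (simp add: field_simps)
qed

text \<open>
  Area is preserved because \<open>\<rho>\<close> is translated, and the inverse is the shift by \<open>-v\<close>.
\<close>

lemma area_preserving_radial_shift:
  "area_preserving_embedding {z. z \<noteq> 0 \<and> 0 < pi * (cmod z)\<^sup>2 + v} (radial_shift v)"
proof -
  define Q where "Q = {z. z \<noteq> 0 \<and> 0 < pi * (cmod z)\<^sup>2 + v}"
  define n where "n = (\<lambda>z. (Re z)\<^sup>2 + (Im z)\<^sup>2)"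
  define h where "h = (\<lambda>z. sqrt (1 + v * inverse (pi * n z)))"
  have Q_eq: "Q = (- {0}) \<inter> {z. 0 < pi * (cmod z)\<^sup>2 + v}" by (auto simp: Q_def)
  have open_Q: "open Q" unfolding Q_eq
    by (intro open_Int open_Collect_less continuous_intros)
  have n: "n z > 0" if "z \<in> Q" for z
    using that by (simp add: Q_def n_def flip: cmod_power2)
  have pos: "1 + v * inverse (pi * n z) > 0" if "z \<in> Q" for z
  proof -
    have "1 + v * inverse (pi * n z) = (pi * n z + v) / (pi * n z)"
      using n[OF that] by (simp add: field_simps)
    then show ?thesis using that n[OF that] by (simp add: Q_def n_def cmod_power2)
  qed
  have f: "radial_shift v = (\<lambda>z. h z *\<^sub>R z)" by (simp add: radial_shift_def h_def n_def fun_eq_iff)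
  have smooth_n: "smooth_on Q n"
    unfolding n_def power2_eq_square
    by (intro smooth_on_add smooth_on_mult smooth_on_bounded_linear bounded_linear_Re
        bounded_linear_Im open_Q)
  have "smooth_on Q (\<lambda>z. pi * n z)"
    by (rule smooth_on_mult[OF open_Q smooth_on_const[OF open_Q] smooth_n])
  then have "smooth_on Q (\<lambda>z. inverse (pi * n z))"
    by (rule smooth_on_inverse_compose[OF open_Q]) (use n in simp)
  then have "smooth_on Q (\<lambda>z. v * inverse (pi * n z))"
    by (rule smooth_on_mult[OF open_Q smooth_on_const[OF open_Q]])
  then have "smooth_on Q (\<lambda>z. 1 + v * inverse (pi * n z))"
    by (rule smooth_on_add[OF open_Q smooth_on_const[OF open_Q]])
  then have "smooth_on Q h"
    unfolding h_def by (rule smooth_on_sqrt_compose[OF open_Q]) (use pos in simp)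
  then have smooth: "smooth_on Q (radial_shift v)"
    unfolding f by (rule smooth_on_scaleR[OF open_Q _ smooth_on_bounded_linear[OF open_Q bounded_linear_ident]])
  have der: "\<exists>D. (radial_shift v has_derivative D) (at z) \<and>
      (\<forall>u w. Re (D u) * Im (D w) - Im (D u) * Re (D w) = Re u * Im w - Im u * Re w)"
    if z: "z \<in> Q" for z
  proof -
    have nz: "n z > 0" and hz: "h z > 0" using n[OF z] pos[OF z] by (simp_all add: h_def)
    define \<kappa> where "\<kappa> = - (v / (pi * (n z)\<^sup>2 * h z))"
    have hh: "h z * h z = 1 + v / (pi * n z)"
      using pos[OF z] by (simp add: h_def divide_inverse)
    have "((\<lambda>r. sqrt (1 + v * inverse (pi * r))) has_real_derivative \<kappa> / 2) (at (n z))"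
      using nz pos[OF z] hz unfolding \<kappa>_def h_def
      by (auto intro!: derivative_eq_intros simp: field_simps power2_eq_square)
    then have "((\<lambda>r. sqrt (1 + v * inverse (pi * r))) has_derivative (\<lambda>t. (\<kappa> / 2) * t)) (at (n z))"
      by (simp only: has_field_derivative_def)
    moreover have "(n has_derivative (\<lambda>u. 2 * (Re z * Re u + Im z * Im u))) (at z)"
      unfolding n_def by (auto intro!: derivative_eq_intros simp: algebra_simps)
    ultimately have "(h has_derivative (\<lambda>u. (\<kappa> / 2) * (2 * (Re z * Re u + Im z * Im u)))) (at z)"
      unfolding h_def by (rule has_derivative_compose[rotated])
    let ?D = "\<lambda>u. h z *\<^sub>R u + ((\<kappa> / 2) * (2 * (Re z * Re u + Im z * Im u))) *\<^sub>R z"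
    from \<open>(h has_derivative _) (at z)\<close> have "((\<lambda>z. h z *\<^sub>R z) has_derivative ?D) (at z)"
      by (rule has_derivative_scaleR[OF _ has_derivative_ident])
    moreover have "Re (?D u) * Im (?D w) - Im (?D u) * Re (?D w) = Re u * Im w - Im u * Re w" for u w
    proof -
      \<comment> \<open>The Jacobian is the derivative of \<open>\<rho> + v\<close> with respect to \<open>\<rho>\<close>, expressed by \<open>h\<close>.\<close>
      have one: "h z * h z + h z * \<kappa> * n z = 1"
        unfolding hh \<kappa>_def using nz hz by (simp add: field_simps power2_eq_square)
      have "Re (?D u) * Im (?D w) - Im (?D u) * Re (?D w)
        = (h z * h z + h z * \<kappa> * n z) * (Re u * Im w - Im u * Re w)"
        by (simp add: n_def power2_eq_square algebra_simps)
      then show ?thesis by (simp add: one)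
    qed
    ultimately show ?thesis unfolding f by blast
  qed
  have inv: "continuous_on (radial_shift v ` Q) (radial_shift (- v))"
  proof -
    have "(Re w)\<^sup>2 + (Im w)\<^sup>2 \<noteq> 0" if "w \<in> radial_shift v ` Q" for w
      using that radial_shift_area by (force simp: Q_def simp flip: cmod_power2)
    then show ?thesis unfolding radial_shift_def by (intro continuous_intros) auto
  qed
  have "radial_shift (- v) (radial_shift v z) = z" if z: "z \<in> Q" for z
  proof -
    let ?w = "radial_shift v z"
    have r: "pi * (cmod ?w)\<^sup>2 = pi * (cmod z)\<^sup>2 + v" using radial_shift_area z by (simp add: Q_def)
    have "radial_shift (- v) ?w = sqrt (1 - v * inverse (pi * (cmod z)\<^sup>2 + v)) *\<^sub>R ?w"
      by (simp only: radial_shift_eq[of "- v"] r mult_minus_left diff_conv_add_uminus)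
    also have "\<dots> = sqrt ((1 - v * inverse (pi * (cmod z)\<^sup>2 + v)) * (1 + v * inverse (pi * (cmod z)\<^sup>2))) *\<^sub>R z"
      by (simp only: radial_shift_eq[of v] real_sqrt_mult scaleR_scaleR)
    also have "(1 - v * inverse (pi * (cmod z)\<^sup>2 + v)) * (1 + v * inverse (pi * (cmod z)\<^sup>2)) = 1"
    proof -
      have "0 < pi * (cmod z)\<^sup>2" "0 < pi * (cmod z)\<^sup>2 + v" using z by (simp_all add: Q_def)
      moreover have "(1 - v * inverse (s + v)) * (1 + v * inverse s) = 1" if "0 < s" "0 < s + v" for s :: real
        using that by (simp add: divide_simps)
      ultimately show ?thesis by blast
    qed
    finally show ?thesis by simp
  qed
  then show ?thesis
    unfolding area_preserving_embedding_def Q_def[symmetric]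
    using open_Q smooth der inv by blast
qed

section \<open>The finger move\<close>

text \<open>
  The coordinates \<open>X = - exp (-kx)\<close> and \<open>Y = y exp (kx)\<close> on the plane satisfy
  \<open>dX \<and> dY = k dx \<and> dy\<close>, so every shear \<open>(X, Y) \<mapsto> (X - B(Y), Y)\<close> preserves area.  It maps the
  half-plane \<open>X < 0\<close> into itself if \<open>B \<ge> 0\<close>.  The finger move is this shear for
  \<open>B(Y) = cd / (d + Y\<^sup>2)\<close>.  Back in \<open>x\<close> and \<open>y\<close>, it divides \<open>exp (kx)\<close> by \<open>m = 1 + exp (kx) B(Y)\<close> and
  multiplies \<open>y\<close> by \<open>m\<close>, where \<open>m\<close> is the function \<open>stretch\<close>.

  All points move to the left along the curves \<open>Y = const\<close>; the strips between these curves are narrow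
  for large \<open>x\<close> and open up as \<open>x\<close> decreases.  The constant \<open>k\<close> governs how far points with
  \<open>x \<le> 0\<close> move, and \<open>d\<close> the width of the finger.
\<close>

definition stretch :: "real \<Rightarrow> real \<Rightarrow> real \<Rightarrow> complex \<Rightarrow> real" where
  "stretch k c d z = 1 + (c * d) * (exp (k * Re z) * inverse (d + (Im z * exp (k * Re z)) * (Im z * exp (k * Re z))))"

definition finger_move :: "real \<Rightarrow> real \<Rightarrow> real \<Rightarrow> complex \<Rightarrow> complex" where
  "finger_move k c d z = Complex (Re z - ln (stretch k c d z) / k) (Im z * stretch k c d z)"

lemma stretch_ge_1:
  assumes "0 \<le> c" "0 < d"
  shows "1 \<le> stretch k c d z"
  using assms by (simp add: stretch_def)

lemma smooth_stretch:
  assumes "0 \<le> c" "0 < d"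
  shows "smooth_on UNIV (stretch k c d)"
proof -
  have E: "smooth_on UNIV (\<lambda>z. exp (k * Re z))"
    by (rule smooth_on_exp_compose[OF open_UNIV smooth_on_mult[OF open_UNIV smooth_on_const[OF open_UNIV]
          smooth_on_bounded_linear[OF open_UNIV bounded_linear_Re]]])
  have Y: "smooth_on UNIV (\<lambda>z. Im z * exp (k * Re z))"
    by (rule smooth_on_mult[OF open_UNIV smooth_on_bounded_linear[OF open_UNIV bounded_linear_Im] E])
  have "smooth_on UNIV (\<lambda>z. d + (Im z * exp (k * Re z)) * (Im z * exp (k * Re z)))"
    by (rule smooth_on_add[OF open_UNIV smooth_on_const[OF open_UNIV] smooth_on_mult[OF open_UNIV Y Y]])
  then have "smooth_on UNIV (\<lambda>z. inverse (d + (Im z * exp (k * Re z)) * (Im z * exp (k * Re z))))"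
    by (rule smooth_on_inverse_compose[OF open_UNIV]) (simp add: add_pos_nonneg assms)
  then have "smooth_on UNIV (\<lambda>z. exp (k * Re z) * inverse (d + (Im z * exp (k * Re z)) * (Im z * exp (k * Re z))))"
    by (rule smooth_on_mult[OF open_UNIV E])
  then show ?thesis
    unfolding stretch_def[abs_def]
    by (intro smooth_on_add[OF open_UNIV smooth_on_const[OF open_UNIV]]
        smooth_on_mult[OF open_UNIV smooth_on_const[OF open_UNIV]])
qed

lemma smooth_finger_move:
  assumes "0 \<le> c" "0 < d"
  shows "smooth_on UNIV (finger_move k c d)"
proof -
  have m: "0 < stretch k c d z" for z using stretch_ge_1[OF assms, of k z] by linarith
  have "smooth_on UNIV (\<lambda>z. Re z + ln (stretch k c d z) * (- 1 / k))"
    by (intro smooth_on_add[OF open_UNIV] smooth_on_bounded_linear[OF open_UNIV bounded_linear_Re]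
        smooth_on_mult[OF open_UNIV _ smooth_on_const[OF open_UNIV]]
        smooth_on_ln_compose[OF open_UNIV smooth_stretch[OF assms] m])
  then have "smooth_on UNIV (\<lambda>z. (Re z + ln (stretch k c d z) * (- 1 / k)) *\<^sub>R (1::complex))"
    by (rule smooth_on_scaleR[OF open_UNIV _ smooth_on_const[OF open_UNIV]])
  moreover have "smooth_on UNIV (\<lambda>z. (Im z * stretch k c d z) *\<^sub>R \<i>)"
    by (intro smooth_on_scaleR[OF open_UNIV _ smooth_on_const[OF open_UNIV]]
      smooth_on_mult[OF open_UNIV smooth_on_bounded_linear[OF open_UNIV bounded_linear_Im]
        smooth_stretch[OF assms]])
  ultimately have "smooth_on UNIV (\<lambda>z. (Re z + ln (stretch k c d z) * (- 1 / k)) *\<^sub>R (1::complex)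
      + (Im z * stretch k c d z) *\<^sub>R \<i>)"
    by (rule smooth_on_add[OF open_UNIV])
  moreover have "finger_move k c d = (\<lambda>z. (Re z + ln (stretch k c d z) * (- 1 / k)) *\<^sub>R (1::complex)
      + (Im z * stretch k c d z) *\<^sub>R \<i>)"
    by (simp add: fun_eq_iff finger_move_def complex_eq_iff)
  ultimately show ?thesis by simp
qed

text \<open>
  With \<open>m - 1 = exp (kx) B(Y)\<close>, the partial derivatives of \<open>m\<close> satisfy \<open>m\<^sub>x = k (m - 1 + y m\<^sub>y)\<close>.  This
  is exactly the condition for the Jacobian \<open>m + y m\<^sub>y - m\<^sub>x / k\<close> to be 1.
\<close>

lemma finger_move_area:
  assumes "0 < k" "0 \<le> c" "0 < d"
  shows "\<exists>D. (finger_move k c d has_derivative D) (at z) \<and>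
      (\<forall>u w. Re (D u) * Im (D w) - Im (D u) * Re (D w) = Re u * Im w - Im u * Re w)"
proof -
  define E where "E = exp (k * Re z)"
  define P where "P = d + (Im z * E) * (Im z * E)"
  define m where "m = stretch k c d z"
  define my where "my = - (c * d * E * (2 * Im z * E * E) / P\<^sup>2)"
  define mx where "mx = k * (m - 1 + Im z * my)"
  have P: "P > 0" using assms by (simp add: P_def add_pos_nonneg)
  have m: "m > 0" using stretch_ge_1[OF assms(2,3), of k z] by (simp add: m_def)
  have dm: "(stretch k c d has_derivative (\<lambda>u. mx * Re u + my * Im u)) (at z)"
  proof -
    have E': "((\<lambda>z. exp (k * Re z)) has_derivative (\<lambda>u. E * (k * Re u))) (at z)"
      unfolding E_def by (auto intro!: derivative_eq_intros)
    have Y': "((\<lambda>z. Im z * exp (k * Re z)) has_derivative (\<lambda>u. Im z * (E * (k * Re u)) + Im u * E)) (at z)"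
      using has_derivative_mult[OF bounded_linear_imp_has_derivative[OF bounded_linear_Im] E']
      by (simp add: E_def)
    have "((\<lambda>z. d + (Im z * exp (k * Re z)) * (Im z * exp (k * Re z))) has_derivative
        (\<lambda>u. 2 * (Im z * E) * (Im z * (E * (k * Re u)) + Im u * E))) (at z)"
      by (rule has_derivative_eq_rhs[OF has_derivative_add[OF has_derivative_const has_derivative_mult[OF Y' Y']]])
        (simp add: E_def algebra_simps)
    then have "((\<lambda>z. inverse (d + (Im z * exp (k * Re z)) * (Im z * exp (k * Re z)))) has_derivative
        (\<lambda>u. - (inverse P * (2 * (Im z * E) * (Im z * (E * (k * Re u)) + Im u * E)) * inverse P))) (at z)"
      using P unfolding P_def E_def by (intro Deriv.has_derivative_inverse) auto
    from has_derivative_mult[OF E' this]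
    have "((\<lambda>z. exp (k * Re z) * inverse (d + (Im z * exp (k * Re z)) * (Im z * exp (k * Re z)))) has_derivative
        (\<lambda>u. E * - (inverse P * (2 * (Im z * E) * (Im z * (E * (k * Re u)) + Im u * E)) * inverse P)
          + E * (k * Re u) * inverse P)) (at z)"
      by (simp add: E_def P_def)
    from has_derivative_add[OF has_derivative_const has_derivative_mult_right[OF this]]
    have *: "(stretch k c d has_derivative (\<lambda>u. 0 + (c * d) * (E * - (inverse P * (2 * (Im z * E)
         * (Im z * (E * (k * Re u)) + Im u * E)) * inverse P) + E * (k * Re u) * inverse P))) (at z)"
      unfolding stretch_def[abs_def] .
    have m1: "m - 1 = c * d * E * inverse P" by (simp add: m_def stretch_def E_def P_def)
    show ?thesis
      by (rule has_derivative_eq_rhs[OF *], rule ext)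
        (simp add: mx_def my_def m1 power2_eq_square divide_inverse algebra_simps)
  qed
  let ?a = "\<lambda>u. mx * Re u + my * Im u"
  let ?D = "\<lambda>u. Complex (Re u - ?a u / (k * m)) (Im z * ?a u + Im u * m)"
  have "((\<lambda>z. ln (stretch k c d z)) has_derivative (\<lambda>u. ?a u * inverse m)) (at z)"
    using has_derivative_ln[OF _ dm] m by (simp add: m_def divide_inverse)
  then have "((\<lambda>z. Re z - ln (stretch k c d z) / k) has_derivative (\<lambda>u. Re u - ?a u * inverse m / k)) (at z)"
    by (intro has_derivative_diff bounded_linear.has_derivative[OF bounded_linear_divide]
        bounded_linear_imp_has_derivative bounded_linear_Re)
  then have 1: "((\<lambda>z. Re z - ln (stretch k c d z) / k) has_derivative (\<lambda>u. Re u - ?a u / (k * m))) (at z)"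
    by (simp add: divide_inverse mult_ac)
  have 2: "((\<lambda>z. Im z * stretch k c d z) has_derivative (\<lambda>u. Im z * ?a u + Im u * m)) (at z)"
    using has_derivative_mult[OF bounded_linear_imp_has_derivative[OF bounded_linear_Im] dm]
    by (simp add: m_def)
  have "(finger_move k c d has_derivative ?D) (at z)"
    using has_derivative_add[OF has_derivative_scaleR_left[OF 1, of 1] has_derivative_scaleR_left[OF 2, of \<i>]]
    by (simp add: finger_move_def[abs_def] Complex_eq scaleR_conv_of_real mult.commute)
  moreover have "Re (?D u) * Im (?D w) - Im (?D u) * Re (?D w) = Re u * Im w - Im u * Re w" for u w
  proof -
    have "k * m * (Re (?D u) * Im (?D w) - Im (?D u) * Re (?D w))
        = (k * m * Re u - ?a u) * (Im z * ?a w + Im w * m) - (Im z * ?a u + Im u * m) * (k * m * Re w - ?a w)"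
      using assms(1) m by (simp add: field_simps)
    also have "\<dots> = k * m * (Re u * Im w - Im u * Re w)"
      unfolding mx_def by (simp add: algebra_simps)
    finally show ?thesis using assms(1) m by simp
  qed
  ultimately show ?thesis by blast
qed

text \<open>
  The shear is undone by \<open>X \<mapsto> X + B(Y)\<close>.  The function called \<open>X\<close> here is the negative of the old
  coordinate \<open>X\<close>, computed from the image point.
\<close>

lemma finger_move_left_inverse:
  assumes "0 < k" "0 \<le> c" "0 < d"
  defines "Y \<equiv> \<lambda>w. Im w * exp (k * Re w)"
  defines "X \<equiv> \<lambda>w. exp (- (k * Re w)) - c * d / (d + Y w * Y w)"
  defines "g \<equiv> \<lambda>w. Complex (- ln (X w) / k) (Y w * X w)"
  shows "g (finger_move k c d z) = z" "continuous_on (range (finger_move k c d)) g"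
proof -
  have Y: "Y (finger_move k c d z) = Y z" and X: "X (finger_move k c d z) = exp (- (k * Re z))" for z
  proof -
    define m where "m = stretch k c d z"
    have m: "m > 0" using stretch_ge_1[OF assms(2,3), of k z] by (simp add: m_def)
    have e: "exp (k * (Re z - ln m / k)) = exp (k * Re z) / m"
      using assms(1) m by (simp add: right_diff_distrib exp_diff)
    then show Y: "Y (finger_move k c d z) = Y z"
      using m by (simp add: Y_def finger_move_def flip: m_def)
    have "exp (- (k * (Re z - ln m / k))) = inverse (exp (k * (Re z - ln m / k)))"
      by (rule exp_minus)
    also have "\<dots> = m * exp (- (k * Re z))"
      unfolding e using m by (simp add: exp_minus divide_inverse)
    also have "m * exp (- (k * Re z)) = exp (- (k * Re z)) + c * d / (d + Y z * Y z)"
      by (simp add: m_def stretch_def Y_def exp_minus field_simps)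
    finally show "X (finger_move k c d z) = exp (- (k * Re z))"
      unfolding X_def Y by (simp add: finger_move_def flip: m_def)
  qed
  show "g (finger_move k c d z) = z"
    using assms(1) by (simp add: g_def X Y complex_eq_iff) (simp add: Y_def exp_minus)
  have Xpos: "X w > 0" if "w \<in> range (finger_move k c d)" for w using that X by auto
  have d: "d + t * t \<noteq> 0" for t :: real
    using assms(3) by (metis add_pos_nonneg less_irrefl zero_le_square)
  have contY: "continuous_on S Y" for S unfolding Y_def by (intro continuous_intros)
  have contX: "continuous_on S X" for S
    unfolding X_def by (intro continuous_intros contY) (auto simp: d)
  show "continuous_on (range (finger_move k c d)) g"
    unfolding g_def Complex_eq
    by (intro continuous_intros contX contY) (use assms(1) Xpos in \<open>auto simp: less_imp_neq[symmetric]\<close>)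
qed

text \<open>
  For \<open>c = 1 - exp (-kb)\<close>, the point \<open>b\<close> of the real axis, where \<open>B = c\<close>, moves to 0.
\<close>

lemma finger_move_misses_0:
  assumes "0 < k" "0 < d" "finger_move k (1 - exp (- (k * b))) d z = 0" "0 \<le> b"
  shows "z = of_real b"
proof -
  define c where "c = 1 - exp (- (k * b))"
  define m where "m = stretch k c d z"
  have c: "0 \<le> c" using assms by (simp add: c_def)
  have m: "m > 0" using stretch_ge_1[OF c assms(2), of k z] by (simp add: m_def)
  have "Complex (Re z - ln m / k) (Im z * m) = 0" using assms(3) by (simp add: finger_move_def c_def m_def)
  then have "ln m = k * Re z" and Im: "Im z = 0" using m assms(1) by (auto simp: complex_eq_iff field_simps)
  then have "m = exp (k * Re z)" using m by (metis exp_ln)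
  moreover have "m = 1 + c * exp (k * Re z)" using Im assms(2) by (simp add: m_def stretch_def)
  ultimately have "exp (k * Re z) * exp (- (k * b)) = 1" by (simp add: c_def algebra_simps)
  then have "exp (k * Re z - k * b) = exp 0" by (simp add: exp_diff exp_minus divide_inverse)
  then have "Re z = b" using assms(1) by simp
  then show ?thesis using Im by (simp add: complex_eq_iff)
qed

text \<open>
  Vertically, \<open>y\<^sup>2 (m - 1) \<le> d exp (-kx)\<close>, which is small with \<open>d\<close> for bounded \<open>x\<close>.  Horizontally, a point
  with \<open>x \<ge> 0\<close> moves towards 0 and at most \<open>1/k\<close> beyond it, and a point with \<open>x < 0\<close> moves by at most
  \<open>exp (-k|x|) / k\<close>.
\<close>

lemma finger_move_radius:
  assumes "0 < k" "0 \<le> c" "c \<le> 1" "0 < d" "cmod z \<le> b"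
  shows "(cmod (finger_move k c d z))\<^sup>2 \<le> (cmod z)\<^sup>2 + 3 / k\<^sup>2 + d * exp (k * b) * (2 + exp (k * b))"
proof -
  define x y E m where "x = Re z" and "y = Im z" and "E = exp (k * x)" and "m = stretch k c d z"
  define L where "L = ln m"
  have E: "E > 0" "E \<le> exp (k * b)" "inverse E \<le> exp (k * b)"
  proof -
    have "x \<le> b" "- x \<le> b" using assms(5) abs_Re_le_cmod[of z] by (simp_all add: x_def)
    then have "k * x \<le> k * b" "k * (- x) \<le> k * b" using assms(1) by (auto simp only: mult_le_cancel_left_pos)
    then show "E > 0" "E \<le> exp (k * b)" "inverse E \<le> exp (k * b)"
      by (simp_all add: E_def flip: exp_minus)
  qed
  have m1: "1 \<le> m" using stretch_ge_1[OF assms(2,4)] by (simp add: m_def)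
  have m: "m - 1 = c * (d * E / (d + (y * E) * (y * E)))"
    by (simp add: m_def stretch_def E_def x_def y_def divide_inverse mult_ac)
  have P: "0 < d + (y * E) * (y * E)" using assms(4) by (simp add: add_pos_nonneg)
  have mE: "m - 1 \<le> E"
  proof -
    have "d * E / (d + (y * E) * (y * E)) \<le> E"
      using P E by (simp add: divide_le_eq algebra_simps)
    moreover have "0 \<le> d * E / (d + (y * E) * (y * E))" using P E assms(4) by simp
    ultimately show ?thesis unfolding m using assms(2,3) by (metis mult_left_le_one_le order_trans)
  qed
  have my: "y\<^sup>2 * (m - 1) \<le> d * exp (k * b)"
  proof -
    have "y\<^sup>2 * (d * E / (d + (y * E) * (y * E))) \<le> d * inverse E"
      using P E assms(4) by (simp add: divide_le_eq field_simps power2_eq_square)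
    also have "\<dots> \<le> d * exp (k * b)" using E(3) assms(4) by simp
    finally have "y\<^sup>2 * (d * E / (d + (y * E) * (y * E))) \<le> d * exp (k * b)" .
    moreover have "0 \<le> y\<^sup>2 * (d * E / (d + (y * E) * (y * E)))" using P E assms(4) by simp
    moreover have "y\<^sup>2 * (m - 1) = c * (y\<^sup>2 * (d * E / (d + (y * E) * (y * E))))" unfolding m by simp
    ultimately show ?thesis using assms(2,3) by (metis mult_left_le_one_le order_trans)
  qed
  have vertical: "(y * m)\<^sup>2 \<le> y\<^sup>2 + d * exp (k * b) * (2 + exp (k * b))"
  proof -
    have "(y * m)\<^sup>2 = y\<^sup>2 + (y\<^sup>2 * (m - 1)) * (m + 1)" by (simp add: power2_eq_square algebra_simps)
    also have "(y\<^sup>2 * (m - 1)) * (m + 1) \<le> (d * exp (k * b)) * (2 + exp (k * b))"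
      by (rule mult_mono[OF my]) (use mE E m1 assms(4) in \<open>simp_all add: less_imp_le\<close>)
    finally show ?thesis by simp
  qed
  have L: "0 \<le> L" "L \<le> ln (1 + E)" using m1 mE by (simp_all add: L_def)
  have horizontal: "(k * x - L)\<^sup>2 \<le> (k * x)\<^sup>2 + 3"
  proof (cases "0 \<le> k * x")
    case True
    have "1 \<le> E" using True by (simp add: E_def)
    moreover have "2 * E \<le> exp 1 * E"
      using exp_ge_add_one_self[of 1] E(1) by (intro mult_right_mono) simp_all
    ultimately have "1 + E \<le> exp 1 * E" by linarith
    then have "ln (1 + E) \<le> ln (exp 1 * E)" using E by simp
    also have "\<dots> = 1 + k * x" using E by (simp add: ln_mult E_def)
    finally have "- 1 \<le> k * x - L" using L by linarith
    moreover have "k * x - L \<le> k * x" using L by linarith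
    ultimately have "\<bar>k * x - L\<bar> \<le> max 1 (k * x)" by linarith
    then have "(k * x - L)\<^sup>2 \<le> (max 1 (k * x))\<^sup>2" by (metis abs_le_square_iff abs_of_nonneg le_max_iff_disj zero_le_one)
    also have "\<dots> \<le> (k * x)\<^sup>2 + 3" by (simp add: max_def)
    finally show ?thesis .
  next
    case False
    define t where "t = - (k * x)"
    have t: "t > 0" "E = inverse (exp t)" using False by (simp_all add: t_def E_def exp_minus)
    have LE: "L \<le> E" using L(2) E(1) ln_add_one_self_le_self[of E] by linarith
    have "t \<le> exp t" using exp_ge_add_one_self[of t] by linarith
    then have "t * E \<le> 1" by (simp add: t field_simps)
    then have "t * L \<le> 1" using LE t(1) mult_left_mono[of L E t] by linarith
    moreover have "L \<le> 1" using LE t by (simp add: one_le_exp_iff inverse_le_1_iff order_trans)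
    then have "L\<^sup>2 \<le> 1" using L(1) by (simp add: power_le_one)
    moreover have "(k * x - L)\<^sup>2 = (k * x)\<^sup>2 + 2 * (t * L) + L\<^sup>2" by (simp add: t_def power2_eq_square algebra_simps)
    ultimately show ?thesis by linarith
  qed
  have "(x - L / k)\<^sup>2 = (k * x - L)\<^sup>2 / k\<^sup>2" using assms(1) by (simp add: power2_eq_square field_simps)
  also have "\<dots> \<le> ((k * x)\<^sup>2 + 3) / k\<^sup>2" using horizontal by (simp add: divide_right_mono)
  also have "\<dots> = x\<^sup>2 + 3 / k\<^sup>2" using assms(1) by (simp add: power2_eq_square field_simps)
  finally have "(x - L / k)\<^sup>2 \<le> x\<^sup>2 + 3 / k\<^sup>2" .
  then show ?thesis using vertical
    by (simp add: cmod_power2 finger_move_def L_def m_def x_def y_def)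
qed

text \<open>
  Here \<open>k\<close> is chosen first, to make the horizontal part of the error equal to \<open>\<epsilon>/2\<close>, and then \<open>d\<close>
  depending on \<open>k\<close> and \<open>b\<close>.
\<close>

lemma ex_planar_map_avoiding_0:
  assumes "0 < b" "0 < \<epsilon>"
  obtains \<psi> where "area_preserving_embedding UNIV \<psi>"
    "\<And>z. cmod z < b \<Longrightarrow> \<psi> z \<noteq> 0" "\<And>z. cmod z < b \<Longrightarrow> (cmod (\<psi> z))\<^sup>2 \<le> (cmod z)\<^sup>2 + \<epsilon>"
proof -
  define k where "k = sqrt (6 / \<epsilon>)"
  define c where "c = 1 - exp (- (k * b))"
  define d where "d = \<epsilon> / 2 / (exp (k * b) * (2 + exp (k * b)))"
  have k: "0 < k" "3 / k\<^sup>2 = \<epsilon> / 2" using assms by (simp_all add: k_def)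
  have c: "0 \<le> c" "c \<le> 1" using k assms by (simp_all add: c_def)
  have e: "0 < exp (k * b) * (2 + exp (k * b))" by (simp add: add_pos_pos)
  moreover have "\<epsilon> / 2 / s * s = \<epsilon> / 2" if "0 < s" for s using that by simp
  ultimately have d: "0 < d" "d * exp (k * b) * (2 + exp (k * b)) = \<epsilon> / 2"
    using assms unfolding d_def mult.assoc by (blast intro: divide_pos_pos half_gt_zero)+
  show thesis
  proof (rule that)
    show "area_preserving_embedding UNIV (finger_move k c d)"
      unfolding area_preserving_embedding_def
      using smooth_finger_move[OF c(1) d(1)] finger_move_area[OF k(1) c(1) d(1)]
        finger_move_left_inverse[OF k(1) c(1) d(1)] by blast
    show "finger_move k c d z \<noteq> 0" if "cmod z < b" for z
      using finger_move_misses_0[OF k(1) d(1), of b z] that assms by (auto simp: c_def)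
    show "(cmod (finger_move k c d z))\<^sup>2 \<le> (cmod z)\<^sup>2 + \<epsilon>" if "cmod z < b" for z
      using finger_move_radius[OF k(1) c d(1), of z b] that k(2) d(2) by simp
  qed
qed

section \<open>Star-shapedness and transversality\<close>

text \<open>
  A local defining function of \<open>S\<close> has a derivative that kills the tangent space and is not
  zero, so transversality makes its derivative in the radial direction nonzero.
\<close>

lemma smooth_hypersurface_ray_isolated:
  fixes S :: "'a::euclidean_space set"
  assumes S: "smooth_hypersurface S" "x \<in> S" and transverse: "ray_transverse p S x"
  shows "\<forall>\<^sub>F t in at 0. x + t *\<^sub>R (x - p) \<notin> S"
proof -
  obtain W and g :: "'a \<Rightarrow> real" where W: "open W" "x \<in> W" and g: "smooth_on W g"
    and regular: "\<forall>y\<in>W. \<exists>v. frechet_derivative g (at y) v \<noteq> 0" and SW: "S \<inter> W = {y \<in> W. g y = 0}"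
    using bspec[OF S(1)[unfolded smooth_hypersurface_def] S(2)] by (elim exE conjE)
  have nz: "\<exists>v. frechet_derivative g (at x) v \<noteq> 0" using regular W(2) by (rule bspec)
  define D where "D = frechet_derivative g (at x)"
  have D: "(g has_derivative D) (at x)"
    using smooth_on_differentiable[OF g W(2)] by (simp add: D_def frechet_derivative_works)
  interpret D: bounded_linear D using D by (rule has_derivative_bounded_linear)
  have gx: "g x = 0" using S(2) W(2) SW by blast
  have along: "((\<lambda>t. g (\<gamma> t)) has_vector_derivative D v) (at 0)"
    if "(\<gamma> has_vector_derivative v) (at 0)" "\<gamma> 0 = x" for \<gamma> v
  proof -
    have "(g has_derivative D) (at (\<gamma> 0))" using D that(2) by simp
    from has_derivative_compose[OF that(1)[unfolded has_vector_derivative_def] this]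
    show ?thesis by (simp add: has_vector_derivative_def D.scaleR)
  qed
  have tangent: "D v = 0" if v: "v \<in> tangent_space S x" for v
  proof -
    obtain \<epsilon> :: real and \<gamma> :: "real \<Rightarrow> 'a" where e: "\<epsilon> > 0" and \<gamma>: "smooth_on {-\<epsilon><..<\<epsilon>} \<gamma>" "\<gamma> ` {-\<epsilon><..<\<epsilon>} \<subseteq> S" "\<gamma> 0 = x"
      "(\<gamma> has_vector_derivative v) (at (0::real))"
      using v unfolding tangent_space_def mem_Collect_eq by (elim exE conjE)
    let ?T = "{-\<epsilon><..<\<epsilon>} \<inter> \<gamma> -` W"
    have "open ?T"
      by (rule continuous_open_preimage[OF smooth_on_imp_continuous_on[OF \<gamma>(1)] open_greaterThanLessThan W(1)])
    moreover have "0 \<in> ?T" using e \<gamma>(3) W(2) by simp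
    moreover have "g (\<gamma> t) = 0" if "t \<in> ?T" for t
    proof -
      have "\<gamma> t \<in> S \<inter> W" using that \<gamma>(2) by blast
      then show ?thesis unfolding SW by blast
    qed
    ultimately have "((\<lambda>t. 0 :: real) has_vector_derivative D v) (at 0)"
      by (rule has_vector_derivative_transform_within_open[OF along[OF \<gamma>(4,3)]])
    then show "D v = 0" using vector_derivative_unique_at has_vector_derivative_const by blast
  qed
  have Dray: "D (x - p) \<noteq> 0"
  proof
    assume "D (x - p) = 0"
    moreover have "subspace {v. D v = 0}" by (simp add: subspace_def D.zero D.add D.scaleR)
    ultimately have "span (insert (x - p) (tangent_space S x)) \<subseteq> {v. D v = 0}"
      using tangent by (intro span_minimal) auto
    then show False using nz transverse by (auto simp: ray_transverse_def D_def)
  qed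
  define \<phi> where "\<phi> = (\<lambda>t. g (x + t *\<^sub>R (x - p)))"
  have "((\<lambda>t. x + t *\<^sub>R (x - p)) has_vector_derivative (x - p)) (at 0)"
    by (auto intro!: derivative_eq_intros)
  then have "(\<phi> has_real_derivative D (x - p)) (at 0)"
    using along[of "\<lambda>t. x + t *\<^sub>R (x - p)"]
    by (simp add: \<phi>_def has_real_derivative_iff_has_vector_derivative)
  then have "((\<lambda>h. (\<phi> (0 + h) - \<phi> 0) / h) \<longlongrightarrow> D (x - p)) (at 0)"
    by (simp add: DERIV_def)
  then have "\<forall>\<^sub>F h in at 0. (\<phi> (0 + h) - \<phi> 0) / h \<noteq> 0"
    using Dray by (rule tendsto_imp_eventually_ne)
  moreover have "((\<lambda>t. x + t *\<^sub>R (x - p)) \<longlongrightarrow> x + 0 *\<^sub>R (x - p)) (at 0)"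
    by (intro tendsto_intros)
  then have "\<forall>\<^sub>F t in at 0. x + t *\<^sub>R (x - p) \<in> W"
    using topological_tendstoD[OF _ W(1)] W(2) by force
  ultimately show ?thesis
  proof eventually_elim
    case (elim t)
    then have "g (x + t *\<^sub>R (x - p)) \<noteq> 0" by (auto simp: \<phi>_def gx)
    then show ?case using elim(2) SW by blast
  qed
qed

lemma hypersurface_gluing_ray_isolated:
  assumes gl: "hypersurface_gluing H M" and tr: "\<forall>(S, F)\<in>H. \<forall>x\<in>F. ray_transverse p S x"
  shows "\<forall>\<^sub>F t in at 0. x + t *\<^sub>R (x - p) \<notin> M"
proof -
  have M: "M = (\<Union>(S, F)\<in>H. F)" and "finite H" using gl by (auto simp: hypersurface_gluing_def)
  have "\<forall>\<^sub>F t in at 0. x + t *\<^sub>R (x - p) \<notin> snd SF" if "SF \<in> H" for SF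
  proof -
    obtain S F where SF: "SF = (S, F)" by force
    have "smooth_hypersurface S \<and> F \<subseteq> S \<and> F = closure ((top_of_set S) interior_of F)"
      using gl that unfolding hypersurface_gluing_def SF by blast
    then have F: "smooth_hypersurface S" "F \<subseteq> S" "closed F" using closed_closure by metis+
    show ?thesis
    proof (cases "x \<in> F")
      case True
      then have "ray_transverse p S x" using tr that SF by blast
      then have "\<forall>\<^sub>F t in at 0. x + t *\<^sub>R (x - p) \<notin> S"
        using smooth_hypersurface_ray_isolated[OF F(1) subsetD[OF F(2) True]] by simp
      then show ?thesis by (rule eventually_mono) (use F(2) SF in auto)
    next
      case False
      have "((\<lambda>t. x + t *\<^sub>R (x - p)) \<longlongrightarrow> x + 0 *\<^sub>R (x - p)) (at 0)"
        by (intro tendsto_intros)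
      then have "\<forall>\<^sub>F t in at 0. x + t *\<^sub>R (x - p) \<in> - F"
        using topological_tendstoD[of _ _ _ "- F"] F(3) False by force
      then show ?thesis using SF by simp
    qed
  qed
  then have "\<forall>\<^sub>F t in at 0. \<forall>SF\<in>H. x + t *\<^sub>R (x - p) \<notin> snd SF"
    using \<open>finite H\<close> by (simp add: eventually_ball_finite)
  then show ?thesis by (rule eventually_mono) (auto simp: M)
qed

text \<open>
  If the shrunken point were not interior, then by star-shapedness no point of the segment from it to
  \<open>x\<close> would be interior, although the whole segment lies in the closure of the interior.  This segment
  would be a radial one within the frontier.
\<close>

lemma shrink_closure_into_interior:
  fixes A :: "'a::euclidean_space set"
  assumes star: "star_center (interior A) p"
    and iso: "\<And>x. \<forall>\<^sub>F t in at 0. x + t *\<^sub>R (x - p) \<notin> frontier A"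
    and x: "x \<in> closure (interior A)" and l: "0 \<le> l" "l < 1"
  shows "p + l *\<^sub>R (x - p) \<in> interior A"
proof (rule ccontr)
  assume out: "p + l *\<^sub>R (x - p) \<notin> interior A"
  have shrink: "p + t *\<^sub>R (y - p) \<in> interior A" if "y \<in> interior A" "0 \<le> t" "t \<le> 1" for y t
  proof -
    have "p + t *\<^sub>R (y - p) \<in> closed_segment p y"
      using that by (auto simp: in_segment algebra_simps intro!: exI[of _ t])
    then show ?thesis using star that(1) unfolding star_center_def by blast
  qed
  have front: "p + t *\<^sub>R (x - p) \<in> frontier A" if "l \<le> t" "t \<le> 1" for t
  proof -
    have "(\<lambda>y. p + t *\<^sub>R (y - p)) ` closure (interior A) \<subseteq> closure (interior A)"
      using shrink that l closure_subset[of "interior A"]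
      by (intro image_closure_subset continuous_intros) auto
    then have "p + t *\<^sub>R (x - p) \<in> closure A"
      using x closure_mono[OF interior_subset[of A]] by blast
    moreover have "p + t *\<^sub>R (x - p) \<notin> interior A"
    proof
      assume "p + t *\<^sub>R (x - p) \<in> interior A"
      then have "p + (l / t) *\<^sub>R ((p + t *\<^sub>R (x - p)) - p) \<in> interior A"
        by (rule shrink) (use that l in \<open>auto simp: divide_le_eq_1\<close>)
      moreover have "t \<noteq> 0 \<or> l = 0" using that l by auto
      ultimately show False using out by (cases "t = 0") auto
    qed
    ultimately show ?thesis by (simp add: frontier_def)
  qed
  obtain d where d: "d > 0" "\<And>t. t \<noteq> 0 \<Longrightarrow> \<bar>t\<bar> < d \<Longrightarrow> x + t *\<^sub>R (x - p) \<notin> frontier A"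
    using iso[of x] by (auto simp: eventually_at dist_real_def)
  define s where "s = min (d / 2) (1 - l)"
  have s: "0 < s" "s < d" "s \<le> 1 - l" using d(1) l by (auto simp: s_def)
  have "x + (- s) *\<^sub>R (x - p) \<notin> frontier A" using d(2)[of "- s"] s by simp
  moreover have "x + (- s) *\<^sub>R (x - p) = p + (1 - s) *\<^sub>R (x - p)" by (simp add: algebra_simps)
  ultimately show False using front[of "1 - s"] s by simp
qed

section \<open>Invariance of domain for topological hypersurfaces\<close>

text \<open>
  In charts, \<open>f\<close> is an injective continuous map from an open subset of a linear hyperplane into
  another linear hyperplane, so invariance of domain for subspaces of equal dimension applies.
\<close>

lemma invariance_of_domain_hypersurface:
  fixes M N :: "'a::euclidean_space set"
  assumes M: "topological_hypersurface M" and N: "topological_hypersurface N"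
    and U: "openin (top_of_set M) U" and f: "continuous_on U f" "inj_on f U" "f ` U \<subseteq> N"
  shows "openin (top_of_set N) (f ` U)"
proof (subst openin_subopen, intro ballI)
  fix y assume y: "y \<in> f ` U"
  then obtain x where x: "x \<in> U" "y = f x" by blast
  have UM: "U \<subseteq> M" using U by (rule openin_imp_subset)
  obtain U1 V1 and L1 :: "'a set" and h1 k1 where 1: "x \<in> U1" "openin (top_of_set M) U1"
    "subspace L1" "dim L1 = DIM('a) - 1" "openin (top_of_set L1) V1" "homeomorphism U1 V1 h1 k1"
    using bspec[OF M[unfolded topological_hypersurface_def homeomorphic_def] subsetD[OF UM x(1)]]
    by (elim exE conjE)
  obtain U2 V2 and L2 :: "'a set" and h2 k2 where 2: "y \<in> U2" "openin (top_of_set N) U2"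
    "subspace L2" "dim L2 = DIM('a) - 1" "openin (top_of_set L2) V2" "homeomorphism U2 V2 h2 k2"
    using bspec[OF N[unfolded topological_hypersurface_def homeomorphic_def] subsetD[OF f(3) y]]
    by (elim exE conjE)
  define R where "R = (U \<inter> U1) \<inter> f -` U2"
  have RU: "R \<subseteq> U" "R \<subseteq> U1" "f ` R \<subseteq> U2" by (auto simp: R_def)
  have "openin (top_of_set (U \<inter> U1)) R"
    unfolding R_def
  proof (rule continuous_openin_preimage[OF _ _ 2(2)])
    show "continuous_on (U \<inter> U1) f" using f(1) by (rule continuous_on_subset) blast
  qed (use f(3) in blast)
  then have RM: "openin (top_of_set M) R"
    by (rule openin_trans) (use U 1(2) in blast)
  then have "openin (top_of_set U1) R"
    using RU(2) openin_imp_subset[OF 1(2)] by (rule openin_subset_trans)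
  then have hR: "openin (top_of_set V1) (h1 ` R)" by (rule homeomorphism_imp_open_map[OF 1(6)])
  have k1h1: "k1 (h1 z) = z" if "z \<in> R" for z
    using that RU(2) 1(6) by (auto simp: homeomorphism_def)
  have hRV: "h1 ` R \<subseteq> V1" using hR by (rule openin_imp_subset)
  let ?\<phi> = "\<lambda>v. h2 (f (k1 v))"
  have img: "?\<phi> ` h1 ` R = h2 ` f ` R" using k1h1 by (auto simp: image_iff)
  have op: "openin (top_of_set L2) (?\<phi> ` h1 ` R)"
  proof (rule invariance_of_domain_subspaces[OF _ 1(3) 2(3)])
    show "openin (top_of_set L1) (h1 ` R)" using hR 1(5) by (rule openin_trans)
    show "dim L2 \<le> dim L1" using 1(4) 2(4) by simp
    have c1: "continuous_on (h1 ` R) k1"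
      using homeomorphism_cont2[OF 1(6)] hRV by (rule continuous_on_subset)
    have c2: "continuous_on (h1 ` R) (\<lambda>v. f (k1 v))"
      by (rule continuous_on_compose2[OF f(1) c1]) (use k1h1 RU in auto)
    show "continuous_on (h1 ` R) ?\<phi>"
      by (rule continuous_on_compose2[OF homeomorphism_cont1[OF 2(6)] c2]) (use k1h1 RU in auto)
    have "h2 ` U2 = V2" using 2(6) by (rule homeomorphism_image1)
    then show "?\<phi> \<in> h1 ` R \<rightarrow> L2"
      using k1h1 RU openin_imp_subset[OF 2(5)] by fastforce
    show "inj_on ?\<phi> (h1 ` R)"
    proof (intro inj_onI; clarsimp)
      fix a b assume ab: "a \<in> R" "b \<in> R" "h2 (f (k1 (h1 a))) = h2 (f (k1 (h1 b)))"
      then have "h2 (f a) = h2 (f b)" by (simp add: k1h1)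
      moreover have "f a \<in> U2" "f b \<in> U2" using ab RU(3) by auto
      ultimately have "f a = f b" using 2(6) by (metis homeomorphism_def)
      then show "h1 a = h1 b" using f(2) ab RU(1) by (metis inj_onD subsetD)
    qed
  qed
  have "h2 ` f ` R \<subseteq> V2" using RU(3) homeomorphism_image1[OF 2(6)] by blast
  then have "openin (top_of_set V2) (h2 ` f ` R)"
    using openin_subset_trans[OF op[unfolded img]] openin_imp_subset[OF 2(5)] by blast
  then have "openin (top_of_set U2) (k2 ` h2 ` f ` R)"
    using homeomorphism_imp_open_map[OF homeomorphism_symD[OF 2(6)]] by blast
  moreover have "k2 ` h2 ` f ` R = f ` R"
  proof -
    have "k2 (h2 w) = w" if "w \<in> f ` R" for w
      using that RU(3) 2(6) by (auto simp: homeomorphism_def)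
    then show ?thesis by (force simp: image_iff)
  qed
  ultimately have "openin (top_of_set N) (f ` R)" using 2(2) openin_trans by metis
  moreover have "y \<in> f ` R" using x 1(1) 2(1) by (auto simp: R_def)
  ultimately show "\<exists>T. openin (top_of_set N) T \<and> y \<in> T \<and> T \<subseteq> f ` U" using RU(1) by blast
qed

lemma topological_hypersurface_coord_hyperplane:
  "topological_hypersurface (coord_hyperplane i :: (real^'n) set)"
proof -
  let ?P = "coord_hyperplane i :: (real^'n) set"
  have P: "?P = {x. axis i 1 \<bullet> x = 0}" by (auto simp: coord_hyperplane_def inner_axis')
  have "subspace ?P" unfolding P by (rule subspace_hyperplane)
  moreover have "dim ?P = DIM(real^'n) - 1" unfolding P by (rule dim_hyperplane) (simp add: axis_eq_0_iff)
  ultimately show ?thesis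
    unfolding topological_hypersurface_def by (metis homeomorphic_refl openin_subtopology_self)
qed

section \<open>Regions closed under lowering a coordinate\<close>

definition scale_coord :: "'n \<Rightarrow> real \<Rightarrow> real^'n \<Rightarrow> real^'n" where
  "scale_coord i s x = (\<chi> j. if j = i then s * x $ j else x $ j)"

lemma scale_coord_nth: "scale_coord i s x $ j = (if j = i then s * x $ j else x $ j)"
  by (simp add: scale_coord_def)

lemma scale_coord_1 [simp]: "scale_coord i 1 x = x"
  by (simp add: vec_eq_iff scale_coord_nth)

lemma scale_coord_scale_coord [simp]: "scale_coord i s (scale_coord i t x) = scale_coord i (s * t) x"
  by (simp add: vec_eq_iff scale_coord_nth)

lemma continuous_on_scale_coord: "continuous_on S (scale_coord i s)"
proof -
  have "linear (scale_coord i s)"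
    by (rule linearI) (simp_all add: vec_eq_iff scale_coord_nth algebra_simps)
  then show ?thesis by (simp add: linear_continuous_on linear_conv_bounded_linear)
qed

lemma continuous_on_scale_coord_factor: "continuous_on S (\<lambda>s. scale_coord i s x)"
proof -
  have "(\<lambda>s. scale_coord i s x) = (\<lambda>s. scale_coord i 0 x + s *\<^sub>R axis i (x $ i))"
    by (simp add: fun_eq_iff vec_eq_iff scale_coord_nth axis_def)
  moreover have "continuous_on S (\<lambda>s. scale_coord i 0 x + s *\<^sub>R axis i (x $ i))"
    by (intro continuous_intros)
  ultimately show ?thesis by (simp only:)
qed

text \<open>
  For a region in the nonnegative orthant this says that with a point it contains the whole segment
  from the point to its projection to the \<open>i\<close>-th coordinate hyperplane.  Multiplying the coordinate,
  rather than subtracting from it, keeps the orthant invariant.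
\<close>

definition lowerable :: "'n \<Rightarrow> (real^'n) set \<Rightarrow> bool" where
  "lowerable i A \<longleftrightarrow> (\<forall>x\<in>A. \<forall>s\<in>{0..1}. scale_coord i s x \<in> A)"

text \<open>
  The factor 0 is obtained as a limit.
\<close>

lemma lowerableI_closed:
  assumes "closed A" and pos: "\<And>x s. x \<in> A \<Longrightarrow> 0 < s \<Longrightarrow> s \<le> 1 \<Longrightarrow> scale_coord i s x \<in> A"
  shows "lowerable i A"
  unfolding lowerable_def
proof
  fix x assume x: "x \<in> A"
  have "closed ((\<lambda>s. scale_coord i s x) -` A)"
    by (rule closed_vimage[OF assms(1) continuous_on_scale_coord_factor])
  then have "closure {0<..1} \<subseteq> (\<lambda>s. scale_coord i s x) -` A"
    using pos x by (intro closure_minimal) auto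
  then show "\<forall>s\<in>{0..1}. scale_coord i s x \<in> A" by auto
qed

text \<open>
  The normal line through \<open>x\<close> meets the union of \<open>A\<close> and the hyperplane in \<open>x\<close> and in the projection
  of \<open>x\<close>, hence in all points between them, and these are off the hyperplane.
\<close>

lemma criterion_imp_lowerable:
  fixes A :: "(real^'n) set"
  assumes nonneg: "\<forall>x\<in>A. 0 \<le> x $ i" and "closed A"
    and conn: "\<forall>q. connected (normal_line i q \<inter> (A \<union> coord_hyperplane i))"
  shows "lowerable i A"
proof (rule lowerableI_closed[OF assms(2)])
  fix x s assume x: "x \<in> A" and s: "0 < s" "s \<le> (1::real)"
  show "scale_coord i s x \<in> A"
  proof (cases "x $ i = 0")
    case True
    then have "scale_coord i s x = x" by (simp add: vec_eq_iff scale_coord_nth)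
    then show ?thesis using x by simp
  next
    case False
    then have xi: "0 < x $ i" using nonneg x by force
    define C where "C = normal_line i x \<inter> (A \<union> coord_hyperplane i)"
    have "x = x + 0 *\<^sub>R axis i 1" by simp
    then have "x \<in> C" unfolding C_def normal_line_def using x by blast
    have "scale_coord i 0 x = x + (- (x $ i)) *\<^sub>R axis i 1"
      by (simp add: vec_eq_iff scale_coord_nth axis_def)
    then have "scale_coord i 0 x \<in> C"
      unfolding C_def normal_line_def
      by (intro IntI UnI2) (auto simp: coord_hyperplane_def scale_coord_nth simp del: scaleR_minus_left)
    then have "0 \<in> (\<lambda>y. y $ i) ` C" by (rule rev_image_eqI) (simp add: scale_coord_nth)
    moreover have "x $ i \<in> (\<lambda>y. y $ i) ` C" using \<open>x \<in> C\<close> by blast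
    moreover have "connected ((\<lambda>y. y $ i) ` C)"
      using conn unfolding C_def by (intro connected_continuous_image continuous_intros) auto
    moreover have "0 \<le> s * x $ i" "s * x $ i \<le> x $ i" using s xi by (simp_all add: mult_le_cancel_right1)
    ultimately have "s * x $ i \<in> (\<lambda>y. y $ i) ` C" using connectedD_interval by metis
    then obtain y where y: "y \<in> C" "y $ i = s * x $ i" by auto
    then obtain t where "y = x + t *\<^sub>R axis i 1" by (auto simp: C_def normal_line_def)
    then have "y = scale_coord i s x" using y(2) by (auto simp: vec_eq_iff scale_coord_nth axis_def)
    moreover have "y \<notin> coord_hyperplane i" using y(2) s xi by (simp add: coord_hyperplane_def)
    ultimately show ?thesis using y(1) by (auto simp: C_def)
  qed
qed

text \<open>
  Scaling a coordinate by a positive factor is a homeomorphism, so it maps interior points to interior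
  points.
\<close>

lemma lowerable_closure_interior:
  assumes "lowerable i A"
  shows "lowerable i (closure (interior A))"
proof (rule lowerableI_closed)
  fix x s assume x: "x \<in> closure (interior A)" and s: "0 < s" "s \<le> (1::real)"
  have "scale_coord i s ` interior A = scale_coord i (1 / s) -` interior A"
    using s by (auto simp: image_iff intro!: bexI[of _ "scale_coord i (1 / s) _"])
  then have "open (scale_coord i s ` interior A)"
    by (simp add: continuous_on_scale_coord continuous_open_vimage continuous_on_eq_continuous_at open_vimage)
  moreover have "scale_coord i s ` interior A \<subseteq> A"
    using assms s interior_subset by (fastforce simp: lowerable_def)
  ultimately have "scale_coord i s ` interior A \<subseteq> interior A" by (rule interior_maximal[rotated])
  then have "scale_coord i s ` closure (interior A) \<subseteq> closure (interior A)"
    using closure_subset by (intro image_closure_subset continuous_on_scale_coord) auto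
  then show "scale_coord i s x \<in> closure (interior A)" using x by blast
qed simp

lemma ex_last_parameter:
  fixes \<gamma> :: "real \<Rightarrow> 'a::metric_space"
  assumes "continuous_on UNIV \<gamma>" "compact A" "\<gamma> 1 \<in> A" and bdd: "\<And>t. \<gamma> t \<in> A \<Longrightarrow> t \<le> B"
  obtains t0 where "1 \<le> t0" "\<gamma> t0 \<in> A" "\<And>t. t0 < t \<Longrightarrow> \<gamma> t \<notin> A"
proof -
  define T where "T = {1..B} \<inter> \<gamma> -` A"
  have "compact T" unfolding T_def
    by (intro compact_Int_closed compact_Icc closed_vimage compact_imp_closed assms)
  moreover have "1 \<in> T" using assms(3) bdd by (simp add: T_def)
  ultimately obtain t0 where t0: "t0 \<in> T" "\<And>t. t \<in> T \<Longrightarrow> t \<le> t0"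
    using compact_attains_sup by (metis empty_iff)
  have "\<gamma> t \<notin> A" if "t0 < t" for t
    using t0(2)[of t] that bdd[of t] t0(1) by (auto simp: T_def)
  then show thesis using t0(1) that by (auto simp: T_def)
qed

text \<open>
  Let \<open>K\<close> be the closure of the interior.  Points of \<open>A - K\<close> belong to the frontier, which is a
  topological hypersurface.

  Suppose that a point of \<open>A - K\<close> has a positive \<open>i\<close>-th coordinate, and let \<open>x'\<close> be the highest point of
  \<open>A\<close> above it.  Lowering slightly is an injective continuous map of a neighbourhood of \<open>x'\<close> in the
  frontier into the frontier, hence open.  Points on the line through \<open>x'\<close> just above the image of
  \<open>x'\<close> are therefore images too, namely of points above \<open>x'\<close>, which is a contradiction.

  So \<open>A - K\<close> lies in the coordinate hyperplane, and it is open there, again by invariance of domain.  But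
  starting in a point of \<open>A - K\<close> and moving away from the projection \<open>p'\<close> of the star-center, one never
  returns to \<open>K\<close>, and the last point of \<open>A\<close> contradicts openness.
\<close>

lemma lowerable_eq_closure_interior:
  fixes A :: "(real^'n) set"
  assumes "compact A" and low: "lowerable i A" and nonneg: "\<forall>x\<in>A. 0 \<le> x $ i"
    and hyp: "topological_hypersurface (frontier A)"
    and p: "p \<in> interior A"
    and shrink: "\<And>x l. x \<in> closure (interior A) \<Longrightarrow> 0 \<le> l \<Longrightarrow> l < 1 \<Longrightarrow> p + l *\<^sub>R (x - p) \<in> interior A"
  shows "A = closure (interior A)"
proof -
  define K where "K = closure (interior A)"
  define M where "M = frontier A"
  have "closed A" using assms(1) by (rule compact_imp_closed)
  have KA: "K \<subseteq> A" unfolding K_def using \<open>closed A\<close> interior_subset by (rule closure_minimal[rotated])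
  have MA: "M \<subseteq> A" unfolding M_def using \<open>closed A\<close> by (rule frontier_subset_closed)
  have AKM: "A - K \<subseteq> M"
    unfolding M_def K_def frontier_def using closure_subset by (metis Diff_mono)
  have closedK: "closed K" by (simp add: K_def)
  have lowK: "scale_coord i s x \<in> K" if "x \<in> K" "0 \<le> s" "s \<le> 1" for x s
    using lowerable_closure_interior[OF low] that by (simp add: lowerable_def K_def)
  have lowA: "scale_coord i s x \<in> A" if "x \<in> A" "0 \<le> s" "s \<le> 1" for x s
    using low that by (simp add: lowerable_def)
  obtain B where B: "\<And>x. x \<in> A \<Longrightarrow> norm x \<le> B"
    using compact_imp_bounded[OF assms(1)] by (auto simp: bounded_iff)
  have flat: "x $ i = 0" if x: "x \<in> A - K" for x
  proof (rule ccontr)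
    assume "x $ i \<noteq> 0"
    then have xi: "0 < x $ i" using nonneg x by force
    have bdd: "t \<le> B / x $ i" if "scale_coord i t x \<in> A" for t
    proof -
      have "t * x $ i \<le> B"
        using component_le_norm_cart[of "scale_coord i t x" i] B[OF that] by (simp add: scale_coord_nth)
      then show ?thesis using xi by (simp add: pos_le_divide_eq)
    qed
    have "scale_coord i 1 x \<in> A" using x by simp
    then obtain s0 where s0: "1 \<le> s0" "scale_coord i s0 x \<in> A"
        "\<And>t. s0 < t \<Longrightarrow> scale_coord i t x \<notin> A"
      using ex_last_parameter[OF continuous_on_scale_coord_factor assms(1) _ bdd] by blast
    define x' where "x' = scale_coord i s0 x"
    have x'A: "x' \<in> A" using s0 by (simp add: x'_def)
    have x'K: "x' \<notin> K"
    proof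
      assume "x' \<in> K"
      from lowK[OF this, of "1 / s0"] show False using s0(1) x by (simp add: x'_def)
    qed
    let ?\<gamma> = "\<lambda>s. scale_coord i s x'"
    have "open (?\<gamma> -` (- K))"
      using closedK by (intro open_vimage continuous_on_scale_coord_factor) auto
    moreover have "1 \<in> ?\<gamma> -` (- K)" using x'K by simp
    ultimately obtain e where e: "0 < e" "ball 1 e \<subseteq> ?\<gamma> -` (- K)" by (meson open_contains_ball)
    define s where "s = max (1 / 2) (1 - e / 2)"
    have s: "0 < s" "s < 1" "s \<in> ball 1 e" using e(1) by (auto simp: s_def dist_real_def)
    have sK: "?\<gamma> s \<notin> K" using e(2) s(3) by blast
    define U where "U = M \<inter> (- K \<inter> scale_coord i s -` (- K))"
    have "open (- K \<inter> scale_coord i s -` (- K))"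
      using closedK by (intro open_Int open_vimage continuous_on_scale_coord) auto
    then have "openin (top_of_set M) U" unfolding U_def by (rule openin_open_Int)
    then have "openin (top_of_set M) (scale_coord i s ` U)"
    proof (rule invariance_of_domain_hypersurface[OF hyp[folded M_def] hyp[folded M_def] _ continuous_on_scale_coord])
      show "inj_on (scale_coord i s) U"
      proof (rule inj_on_inverseI)
        show "scale_coord i (1 / s) (scale_coord i s z) = z" for z using s by simp
      qed
      show "scale_coord i s ` U \<subseteq> M"
        using lowA[of _ s] s(1,2) MA AKM by (auto simp: U_def)
    qed
    then obtain V where V: "open V" "scale_coord i s ` U = M \<inter> V" by (auto simp: openin_open)
    have "x' \<in> U" using x'A x'K AKM sK by (auto simp: U_def)
    then have "?\<gamma> s \<in> V" using V(2) by blast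
    have "open (?\<gamma> -` (V \<inter> - K))"
      using closedK V(1) by (intro open_vimage continuous_on_scale_coord_factor) auto
    moreover have "s \<in> ?\<gamma> -` (V \<inter> - K)" using \<open>?\<gamma> s \<in> V\<close> sK by simp
    ultimately obtain e' where e': "0 < e'" "ball s e' \<subseteq> ?\<gamma> -` (V \<inter> - K)" by (meson open_contains_ball)
    \<comment> \<open>The point with factor \<open>r\<close> lies above the image of \<open>x'\<close>, but still below \<open>x'\<close>.\<close>
    define r where "r = min ((s + 1) / 2) (s + e' / 2)"
    have r: "s < r" "r < 1" "r \<in> ball s e'" using e'(1) s by (auto simp: r_def dist_real_def min_def)
    have "?\<gamma> r \<in> A" using lowA[OF x'A] r s by simp
    moreover have "?\<gamma> r \<in> V" "?\<gamma> r \<notin> K" using e'(2) r(3) by auto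
    ultimately have "?\<gamma> r \<in> scale_coord i s ` U" unfolding V(2) using AKM by blast
    then obtain z where z: "z \<in> U" "?\<gamma> r = scale_coord i s z" by auto
    have "z = scale_coord i (1 / s) (scale_coord i s z)" using s by simp
    also have "\<dots> = scale_coord i (r / s * s0) x" unfolding z(2)[symmetric] by (simp add: x'_def)
    finally have "scale_coord i (r / s * s0) x \<in> A" using z(1) MA by (auto simp: U_def)
    moreover have "s0 < r / s * s0" using r s s0(1) by (simp add: field_simps)
    ultimately show False using s0(3) by blast
  qed
  have "A - K = {}"
  proof (rule ccontr)
    assume "A - K \<noteq> {}"
    then obtain x where x: "x \<in> A" "x \<notin> K" by blast
    define p' where "p' = scale_coord i 0 p"
    have "p \<in> K" using p closure_subset by (auto simp: K_def)
    then have p'K: "p' \<in> K" using lowK by (simp add: p'_def)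
    let ?\<gamma> = "\<lambda>t. p' + t *\<^sub>R (x - p')"
    have in_P: "?\<gamma> t \<in> coord_hyperplane i" for t
      using flat x by (simp add: coord_hyperplane_def p'_def scale_coord_nth)
    have starK: "p' + l *\<^sub>R (y - p') \<in> K" if "y \<in> K" "y \<in> coord_hyperplane i" "0 \<le> l" "l < 1" for y l
    proof -
      have "p' + l *\<^sub>R (y - p') = scale_coord i 0 (p + l *\<^sub>R (y - p))"
        using that(2) by (auto simp: vec_eq_iff p'_def scale_coord_nth coord_hyperplane_def)
      moreover have "p + l *\<^sub>R (y - p) \<in> K"
        using shrink[of y l] that closure_subset by (auto simp: K_def)
      ultimately show ?thesis using lowK by simp
    qed
    have nx: "0 < norm (x - p')" using x p'K by auto
    have bdd: "t \<le> (B + norm p') / norm (x - p')" if "?\<gamma> t \<in> A" for t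
    proof -
      have "t * norm (x - p') \<le> norm (t *\<^sub>R (x - p'))" by (simp add: mult_right_mono)
      also have "\<dots> \<le> norm (?\<gamma> t) + norm p'" using norm_triangle_ineq4[of "?\<gamma> t" p'] by simp
      also have "\<dots> \<le> B + norm p'" using B[OF that] by simp
      finally show ?thesis using nx by (simp add: pos_le_divide_eq)
    qed
    have cont: "continuous_on UNIV ?\<gamma>" by (intro continuous_intros)
    have "?\<gamma> 1 \<in> A" using x by simp
    then obtain t0 where t0: "1 \<le> t0" "?\<gamma> t0 \<in> A" "\<And>t. t0 < t \<Longrightarrow> ?\<gamma> t \<notin> A"
      using ex_last_parameter[OF cont assms(1) _ bdd] by blast
    have "?\<gamma> t0 \<notin> K"
    proof
      assume K: "?\<gamma> t0 \<in> K"
      have "t0 \<noteq> 1" using K x by auto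
      then have "1 < t0" using t0(1) by simp
      then have "?\<gamma> 1 \<in> K" using starK[OF K in_P, of "1 / t0"] by simp
      then show False using x by simp
    qed
    have "openin (top_of_set M) (M \<inter> - K)" using closedK by (intro openin_open_Int) auto
    then have "openin (top_of_set (coord_hyperplane i)) ((\<lambda>z. z) ` (M \<inter> - K))"
      using MA flat
      by (intro invariance_of_domain_hypersurface[OF hyp[folded M_def] topological_hypersurface_coord_hyperplane])
        (auto simp: coord_hyperplane_def)
    then obtain V where V: "open V" "M \<inter> - K = coord_hyperplane i \<inter> V" by (auto simp: openin_open)
    have "?\<gamma> t0 \<in> V" using V(2) t0(2) \<open>?\<gamma> t0 \<notin> K\<close> AKM by blast
    moreover have "open (?\<gamma> -` V)" using V(1) cont by (rule open_vimage)
    ultimately obtain e where e: "0 < e" "ball t0 e \<subseteq> ?\<gamma> -` V" by (meson open_contains_ball vimageI)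
    have "t0 + e / 2 \<in> ball t0 e" using e(1) by (simp add: dist_real_def)
    then have "?\<gamma> (t0 + e / 2) \<in> M" using e(2) V(2) in_P by blast
    then show False using t0(3)[of "t0 + e / 2"] e(1) MA by auto
  qed
  then show ?thesis using KA by (auto simp: K_def)
qed

text \<open>
  Lower the coordinates one by one; if \<open>x $ j = 0\<close>, then \<open>w $ j = 0\<close>, and the factor \<open>w $ j / x $ j = 0\<close>
  is the right one also in this case.
\<close>

lemma lowerable_several:
  fixes A :: "(real^'n) set"
  assumes low: "\<And>i. i \<in> I \<Longrightarrow> lowerable i A" and x: "x \<in> A"
    and w: "\<And>i. i \<in> I \<Longrightarrow> 0 \<le> w $ i \<and> w $ i \<le> x $ i" "\<And>i. i \<notin> I \<Longrightarrow> w $ i = x $ i"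
  shows "w \<in> A"
proof -
  have "(\<chi> i. if i \<in> J then w $ i else x $ i) \<in> A" if "finite J" "J \<subseteq> I" for J
    using that
  proof (induction J rule: finite_induct)
    case empty
    then show ?case using x by simp
  next
    case (insert j J)
    let ?s = "w $ j / x $ j"
    have j: "0 \<le> w $ j" "w $ j \<le> x $ j" "lowerable j A" using insert.prems w(1) low by auto
    have "?s \<in> {0..1}" using j by (auto simp: divide_le_eq_1)
    then have "scale_coord j ?s (\<chi> i. if i \<in> J then w $ i else x $ i) \<in> A"
      using j(3) insert by (auto simp: lowerable_def)
    moreover have "scale_coord j ?s (\<chi> i. if i \<in> J then w $ i else x $ i)
        = (\<chi> i. if i \<in> insert j J then w $ i else x $ i)"
      using j insert.hyps(2) by (auto simp: vec_eq_iff scale_coord_nth)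
    ultimately show ?case by simp
  qed
  from this[of I] have "(\<chi> i. if i \<in> I then w $ i else x $ i) \<in> A" by simp
  moreover have "(\<chi> i. if i \<in> I then w $ i else x $ i) = w" using w(2) by (simp add: vec_eq_iff)
  ultimately show ?thesis by simp
qed

text \<open>
  Cutting \<open>w\<close> down to \<open>x\<close> gives a point of \<open>A\<close> at a distance of at most \<open>CARD('n) \<epsilon>\<close> from \<open>w\<close>.  Shrinking by
  \<open>1 / l\<close> maps the compact set \<open>A\<close> into its interior, with some margin \<open>\<delta>\<close>, and therefore \<open>w\<close> into \<open>A\<close>.
\<close>

lemma ex_margin_in_dilation:
  fixes A :: "(real^'n) set"
  assumes "compact A" and low: "\<And>i. i \<in> I \<Longrightarrow> lowerable i A"
    and nonneg: "\<forall>x\<in>A. \<forall>i. 0 \<le> x $ i" and l: "1 < l"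
    and shrink: "\<And>x. x \<in> A \<Longrightarrow> p + (1 / l) *\<^sub>R (x - p) \<in> interior A"
  obtains \<epsilon> where "0 < \<epsilon>"
    "\<And>x w. x \<in> A \<Longrightarrow>
      \<forall>i. if i \<in> I then 0 \<le> w $ i \<and> w $ i \<le> x $ i + \<epsilon> else w $ i = x $ i \<Longrightarrow>
      w \<in> (\<lambda>x. p + l *\<^sub>R (x - p)) ` A"
proof -
  let ?C = "(\<lambda>x. p + (1 / l) *\<^sub>R (x - p)) ` A"
  have "compact ?C" by (intro compact_continuous_image continuous_intros assms(1))
  moreover have "?C \<subseteq> interior A" using shrink by blast
  ultimately obtain \<delta> where \<delta>: "0 < \<delta>" "(\<Union>y\<in>?C. ball y \<delta>) \<subseteq> interior A"
    using compact_subset_open_imp_ball_epsilon_subset[OF _ open_interior] by metis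
  define \<epsilon> where "\<epsilon> = \<delta> / (2 * real CARD('n))"
  have \<epsilon>: "0 < \<epsilon>" "real CARD('n) * \<epsilon> = \<delta> / 2" using \<delta>(1) by (simp_all add: \<epsilon>_def)
  show thesis
  proof (rule that[OF \<epsilon>(1)])
    fix x w assume x: "x \<in> A"
      and "\<forall>i. if i \<in> I then 0 \<le> w $ i \<and> w $ i \<le> x $ i + \<epsilon> else w $ i = x $ i"
    then have w: "\<And>i. i \<in> I \<Longrightarrow> 0 \<le> w $ i \<and> w $ i \<le> x $ i + \<epsilon>" "\<And>i. i \<notin> I \<Longrightarrow> w $ i = x $ i"
      by metis+
    define w' where "w' = (\<chi> i. min (w $ i) (x $ i))"
    have w'A: "w' \<in> A"
      by (rule lowerable_several[OF low x]) (use w nonneg x in \<open>auto simp: w'_def\<close>)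
    have "\<bar>(w - w') $ i\<bar> \<le> \<epsilon>" for i
      using w[of i] \<epsilon>(1) by (cases "i \<in> I") (auto simp: w'_def)
    then have "norm (w - w') \<le> (\<Sum>i\<in>(UNIV :: 'n set). \<epsilon>)"
      using norm_le_l1_cart[of "w - w'"] sum_mono[of UNIV "\<lambda>i. \<bar>(w - w') $ i\<bar>" "\<lambda>i. \<epsilon>"] by force
    then have "norm (w - w') < \<delta>" using \<epsilon>(2) \<delta>(1) by simp
    moreover have "dist (p + (1 / l) *\<^sub>R (w' - p)) (p + (1 / l) *\<^sub>R (w - p)) = norm (w - w') / l"
    proof -
      have "(p + (1 / l) *\<^sub>R (w' - p)) - (p + (1 / l) *\<^sub>R (w - p)) = (1 / l) *\<^sub>R (w' - w)"
        by (simp add: algebra_simps)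
      then show ?thesis using l by (simp add: dist_norm norm_minus_commute)
    qed
    moreover have "norm (w - w') / l \<le> norm (w - w')" using l by (simp add: divide_le_eq mult_le_cancel_left1)
    ultimately have "p + (1 / l) *\<^sub>R (w - p) \<in> ball (p + (1 / l) *\<^sub>R (w' - p)) \<delta>" by simp
    then have "p + (1 / l) *\<^sub>R (w - p) \<in> A" using \<delta>(2) w'A interior_subset by blast
    moreover have "w = p + l *\<^sub>R ((p + (1 / l) *\<^sub>R (w - p)) - p)" using l by simp
    ultimately show "w \<in> (\<lambda>x. p + l *\<^sub>R (x - p)) ` A" by blast
  qed
qed

section \<open>Capacities of toric domains\<close>

lemma capacity_mono:
  "symplectic_capacity c \<Longrightarrow> symplectically_embeds U V \<Longrightarrow> c U \<le> c V"
  by (simp add: symplectic_capacity_def)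

lemma moment_map_nth: "moment_map z $ i = pi * (cmod (z $ i))\<^sup>2"
  by (simp add: moment_map_def)

lemma symplectically_embeds_translate:
  fixes v :: "real^'n"
  assumes U: "\<And>z i. z \<in> U \<Longrightarrow> z $ i \<noteq> 0 \<and> 0 < moment_map z $ i + v $ i"
    and B: "\<And>z. z \<in> U \<Longrightarrow> moment_map z + v \<in> B"
  shows "symplectically_embeds U (toric_domain B)"
proof (rule symplectically_embeds_product[OF area_preserving_radial_shift])
  show "z $ i \<in> {w. w \<noteq> 0 \<and> 0 < pi * (cmod w)\<^sup>2 + v $ i}" if "z \<in> U" for z i
    using U[OF that] by (simp add: moment_map_nth)
  show "(\<chi> i. radial_shift (v $ i) (z $ i)) \<in> toric_domain B" if "z \<in> U" for z
  proof -
    have "moment_map (\<chi> i. radial_shift (v $ i) (z $ i)) = moment_map z + v"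
      using U[OF that] by (simp add: vec_eq_iff moment_map_nth radial_shift_area)
    then show ?thesis using B[OF that] by (simp add: toric_domain_def)
  qed
qed

lemma symplectically_embeds_toric_translate:
  fixes v :: "real^'n"
  assumes A: "\<And>x i. x \<in> A \<Longrightarrow> 0 < x $ i \<and> 0 < (x + v) $ i" and B: "(\<lambda>x. x + v) ` A \<subseteq> B"
  shows "symplectically_embeds (toric_domain A) (toric_domain B)"
proof (rule symplectically_embeds_translate[where v = v])
  fix z :: "complex^'n" and i assume "z \<in> toric_domain A"
  then have z: "moment_map z \<in> A" by (simp add: toric_domain_def)
  show "moment_map z + v \<in> B" using z B by blast
  show "z $ i \<noteq> 0 \<and> 0 < moment_map z $ i + v $ i"
    using A[OF z, of i] by (auto simp: moment_map_nth)
qed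

text \<open>
  The moment map is quadratic, so a factor \<open>l\<close> on the region is a factor \<open>sqrt l\<close> on the domain.
\<close>

lemma capacity_toric_scale:
  fixes A :: "(real^'n) set"
  assumes c: "symplectic_capacity c" and l: "0 < l"
  shows "c (toric_domain ((\<lambda>x. l *\<^sub>R x) ` A)) = ennreal l * c (toric_domain A)"
proof -
  have mm: "moment_map (sqrt l *\<^sub>R z) = l *\<^sub>R moment_map z" for z :: "complex^'n"
    using l by (simp add: vec_eq_iff moment_map_nth power_mult_distrib)
  have "toric_domain ((\<lambda>x. l *\<^sub>R x) ` A) = (\<lambda>z. sqrt l *\<^sub>R z) ` toric_domain A"
  proof (intro subset_antisym subsetI)
    fix z assume "z \<in> toric_domain ((\<lambda>x. l *\<^sub>R x) ` A)"
    then obtain x where x: "x \<in> A" "moment_map z = l *\<^sub>R x" by (auto simp: toric_domain_def)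
    have z: "z = sqrt l *\<^sub>R ((1 / sqrt l) *\<^sub>R z)" using l by simp
    have "l *\<^sub>R moment_map ((1 / sqrt l) *\<^sub>R z) = l *\<^sub>R x"
      by (simp only: mm[symmetric] z[symmetric] x(2))
    then have "moment_map ((1 / sqrt l) *\<^sub>R z) = x" using l by simp
    then have "(1 / sqrt l) *\<^sub>R z \<in> toric_domain A" using x(1) by (simp add: toric_domain_def)
    then show "z \<in> (\<lambda>z. sqrt l *\<^sub>R z) ` toric_domain A" using z by blast
  next
    fix z assume "z \<in> (\<lambda>z. sqrt l *\<^sub>R z) ` toric_domain A"
    then show "z \<in> toric_domain ((\<lambda>x. l *\<^sub>R x) ` A)" by (auto simp: toric_domain_def mm)
  qed
  moreover have "c ((\<lambda>z. sqrt l *\<^sub>R z) ` toric_domain A) = ennreal ((sqrt l)\<^sup>2) * c (toric_domain A)"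
    using c unfolding symplectic_capacity_def by blast
  ultimately show ?thesis using l by simp
qed

text \<open>
  The two regions \<open>p + l (A - p) + w\<close> and \<open>l (A + 1)\<close> are translates of each other within the open orthant.
\<close>

lemma capacity_toric_dilation:
  fixes A :: "(real^'n) set" and p w :: "real^'n"
  assumes c: "symplectic_capacity c" and l: "0 < l"
    and nonneg: "\<forall>x\<in>A. \<forall>i. 0 \<le> x $ i"
    and pos: "\<And>x i. x \<in> A \<Longrightarrow> 0 < (p + l *\<^sub>R (x - p) + w) $ i"
  shows "c (toric_domain ((\<lambda>x. p + l *\<^sub>R (x - p) + w) ` A))
      = ennreal l * c (toric_domain ((\<lambda>x. x + (\<chi> i. 1)) ` A))"
proof -
  let ?e = "(\<chi> i. 1) :: real^'n"
  let ?B = "(\<lambda>x. p + l *\<^sub>R (x - p) + w) ` A"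
  let ?C = "(\<lambda>x. l *\<^sub>R x) ` (\<lambda>x. x + ?e) ` A"
  define v where "v = p - l *\<^sub>R p + w - l *\<^sub>R ?e"
  have v: "l *\<^sub>R (x + ?e) + v = p + l *\<^sub>R (x - p) + w" for x
    by (simp add: v_def algebra_simps)
  have v': "p + l *\<^sub>R (x - p) + w + (- v) = l *\<^sub>R (x + ?e)" for x
    by (simp add: v_def algebra_simps)
  have pos': "0 < (l *\<^sub>R (x + ?e)) $ i" if "x \<in> A" for x i
    using nonneg that l by (simp add: add_nonneg_pos)
  have "symplectically_embeds (toric_domain ?C) (toric_domain ?B)"
  proof (rule symplectically_embeds_toric_translate)
    fix y i assume "y \<in> ?C"
    then obtain x where x: "x \<in> A" "y = l *\<^sub>R (x + ?e)" by blast
    show "0 < y $ i \<and> 0 < (y + v) $ i" unfolding x(2) v using pos pos' x(1) by blast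
  next
    show "(\<lambda>x. x + v) ` ?C \<subseteq> ?B" unfolding image_image v ..
  qed
  moreover have "symplectically_embeds (toric_domain ?B) (toric_domain ?C)"
  proof (rule symplectically_embeds_toric_translate)
    fix y i assume "y \<in> ?B"
    then obtain x where x: "x \<in> A" "y = p + l *\<^sub>R (x - p) + w" by blast
    show "0 < y $ i \<and> 0 < (y + - v) $ i" unfolding x(2) v' using pos pos' x(1) by blast
  next
    show "(\<lambda>x. x + - v) ` ?B \<subseteq> ?C" unfolding image_image v' ..
  qed
  ultimately have "c (toric_domain ?B) = c (toric_domain ?C)"
    by (intro order_antisym capacity_mono[OF c])
  then show ?thesis using capacity_toric_scale[OF c l] by simp
qed

lemma
  fixes X Y :: ennreal
  shows ennreal_le_if_smaller_multiples: "(\<And>l. 0 < l \<Longrightarrow> l < 1 \<Longrightarrow> ennreal l * X \<le> Y) \<Longrightarrow> X \<le> Y"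
    and ennreal_le_if_larger_multiples:
      "1 < b \<Longrightarrow> (\<And>l. 1 < l \<Longrightarrow> l < b \<Longrightarrow> Y \<le> ennreal l * X) \<Longrightarrow> Y \<le> X"
proof -
  have lim: "((\<lambda>l. ennreal l * X) \<longlongrightarrow> X) (at 1 within S)" for S
  proof -
    have "((\<lambda>l. ennreal l * X) \<longlongrightarrow> ennreal 1 * X) (at 1 within S)"
      by (intro tendsto_mult_ennreal tendsto_ennrealI tendsto_ident_at tendsto_const) auto
    then show ?thesis by simp
  qed
  show "X \<le> Y" if *: "\<And>l. 0 < l \<Longrightarrow> l < 1 \<Longrightarrow> ennreal l * X \<le> Y"
  proof (rule tendsto_upperbound[OF lim])
    show "\<forall>\<^sub>F l in at_left 1. ennreal l * X \<le> Y"
      using eventually_at_left_real[of 0 1] by (rule eventually_mono) (use * in auto)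
  qed simp
  show "Y \<le> X" if "1 < b" and *: "\<And>l. 1 < l \<Longrightarrow> l < b \<Longrightarrow> Y \<le> ennreal l * X"
  proof (rule tendsto_lowerbound[OF lim])
    show "\<forall>\<^sub>F l in at_right 1. Y \<le> ennreal l * X"
      using eventually_at_right_real[OF that(1)] by (rule eventually_mono) (use * in auto)
  qed simp
qed

lemma area_preserving_id: "area_preserving_embedding UNIV (\<lambda>z. z)"
  unfolding area_preserving_embedding_def
proof (intro conjI)
  show "smooth_on UNIV (\<lambda>z :: complex. z)"
    by (rule smooth_on_bounded_linear[OF open_UNIV bounded_linear_ident])
  show "\<forall>z\<in>UNIV. \<exists>D. ((\<lambda>z. z) has_derivative D) (at z) \<and>
      (\<forall>u v. Re (D u) * Im (D v) - Im (D u) * Re (D v) = Re u * Im v - Im u * Re v)"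
    by (intro ballI exI[of _ "\<lambda>u. u"]) (simp add: has_derivative_ident)
  show "\<exists>g. continuous_on ((\<lambda>z. z) ` UNIV) g \<and> (\<forall>z\<in>UNIV. g z = z)"
    by (intro exI[of _ "\<lambda>z. z"]) (simp add: continuous_on_id)
qed simp

text \<open>
  Apply the planar map in the factors with \<open>i \<in> I\<close>, and the identity in the others.
\<close>

lemma ex_toric_embedding_off_coordinate_planes:
  fixes A :: "(real^'n) set"
  assumes "bounded A" "0 < \<epsilon>" and pos: "\<And>x i. x \<in> A \<Longrightarrow> i \<notin> I \<Longrightarrow> 0 < x $ i"
  obtains V where "symplectically_embeds (toric_domain A) V"
    "\<And>z i. z \<in> V \<Longrightarrow> z $ i \<noteq> 0"
    "\<And>z. z \<in> V \<Longrightarrow> \<exists>x\<in>A. (\<forall>i\<in>I. moment_map z $ i \<le> x $ i + \<epsilon>) \<and> (\<forall>i. i \<notin> I \<longrightarrow> moment_map z $ i = x $ i)"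
proof -
  obtain R where R: "\<And>x. x \<in> A \<Longrightarrow> norm x \<le> R" using assms(1) by (auto simp: bounded_iff)
  define b where "b = \<bar>R\<bar> + 1"
  have b: "1 \<le> b" "R < pi * b\<^sup>2"
  proof -
    show "1 \<le> b" by (simp add: b_def)
    then have "b \<le> b\<^sup>2" by (simp add: self_le_power)
    also have "\<dots> \<le> pi * b\<^sup>2" using pi_gt3 by (simp add: mult_le_cancel_right1)
    finally show "R < pi * b\<^sup>2" by (simp add: b_def)
  qed
  obtain \<psi> where \<psi>: "area_preserving_embedding UNIV \<psi>" "\<And>z. cmod z < b \<Longrightarrow> \<psi> z \<noteq> 0"
    "\<And>z. cmod z < b \<Longrightarrow> (cmod (\<psi> z))\<^sup>2 \<le> (cmod z)\<^sup>2 + \<epsilon> / pi"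
    using ex_planar_map_avoiding_0[of b "\<epsilon> / pi"] b(1) assms(2) by (metis divide_pos_pos less_le_trans pi_gt_zero zero_less_one)
  define f where "f = (\<lambda>i. if i \<in> I then \<psi> else (\<lambda>z. z))"
  define F where "F = (\<lambda>z :: complex^'n. \<chi> i. f i (z $ i))"
  have small: "cmod (z $ i) < b" if "z \<in> toric_domain A" for z :: "complex^'n" and i
  proof -
    have "moment_map z \<in> A" using that by (simp add: toric_domain_def)
    then have "moment_map z $ i \<le> R" using R component_le_norm_cart[of "moment_map z" i] by fastforce
    then have "pi * (cmod (z $ i))\<^sup>2 < pi * b\<^sup>2"
      unfolding moment_map_nth using b(2) by (rule le_less_trans)
    then have "(cmod (z $ i))\<^sup>2 < b\<^sup>2" by simp
    then show ?thesis using b(1) by (meson le_less_trans not_le power_mono norm_ge_zero zero_le_one order_trans)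
  qed
  show thesis
  proof (rule that)
    show "symplectically_embeds (toric_domain A) (F ` toric_domain A)"
    proof (rule symplectically_embeds_product[where Q = "\<lambda>_. UNIV" and f = f])
      show "area_preserving_embedding UNIV (f i)" for i using \<psi>(1) area_preserving_id by (simp add: f_def)
    qed (auto simp: F_def)
    fix w assume "w \<in> F ` toric_domain A"
    then obtain z where z: "z \<in> toric_domain A" "w = F z" by blast
    then have zA: "moment_map z \<in> A" by (simp add: toric_domain_def)
    show "w $ i \<noteq> 0" for i
      using \<psi>(2)[OF small[OF z(1), of i]] pos[OF zA, of i] by (auto simp: z(2) F_def f_def moment_map_nth)
    have "moment_map w $ i \<le> moment_map z $ i + \<epsilon>" if "i \<in> I" for i
    proof -
      have "pi * (cmod (\<psi> (z $ i)))\<^sup>2 \<le> pi * ((cmod (z $ i))\<^sup>2 + \<epsilon> / pi)"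
        using \<psi>(3)[OF small[OF z(1), of i]] by (rule mult_left_mono) simp
      then show ?thesis using that by (simp add: z(2) F_def f_def moment_map_nth distrib_left)
    qed
    then show "\<exists>x\<in>A. (\<forall>i\<in>I. moment_map w $ i \<le> x $ i + \<epsilon>) \<and> (\<forall>i. i \<notin> I \<longrightarrow> moment_map w $ i = x $ i)"
      using zA by (intro bexI[of _ "moment_map z"]) (auto simp: z(2) F_def f_def moment_map_nth)
  qed
qed

lemma interior_nonneg_imp_pos:
  fixes A :: "(real^'n) set"
  assumes "\<forall>x\<in>A. \<forall>i. 0 \<le> x $ i" "x \<in> interior A"
  shows "0 < x $ i"
proof -
  obtain e where e: "0 < e" "cball x e \<subseteq> A" using assms(2) by (auto simp: mem_interior_cball)
  have "x - e *\<^sub>R axis i 1 \<in> cball x e" using e(1) by (simp add: dist_norm)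
  then have "0 \<le> (x - e *\<^sub>R axis i 1) $ i" using e(2) assms(1) by blast
  then show ?thesis using e(1) by (simp add: axis_def)
qed

theorem theorem1p2:
  fixes A :: "(real^'n) set"
    and p :: "real^'n"
    and H :: "((real^'n) set \<times> (real^'n) set) set"
    and c :: "(complex^'n) set \<Rightarrow> ennreal"
  assumes nonneg: "\<forall>x\<in>A. \<forall>i. 0 \<le> x $ i"
    and compact: "compact A"
    and star: "star_center (interior A) p"
    and boundary: "hypersurface_gluing H (frontier A)"
    and transverse: "\<forall>(S, F)\<in>H. \<forall>x\<in>F. ray_transverse p S x"
    and criterion: "\<forall>i. A \<inter> coord_hyperplane i \<noteq> {} \<longrightarrow>
          (\<forall>q. connected (normal_line i q \<inter> (A \<union> coord_hyperplane i)))"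
    and capacity: "symplectic_capacity c"
  shows "c (toric_domain A) = c (toric_domain ((\<lambda>x. x + (\<chi> i. 1)) ` A))"
proof -
  let ?e = "(\<chi> i. 1) :: real^'n"
  define I where "I = {i. A \<inter> coord_hyperplane i \<noteq> {}}"
  have pos: "0 < x $ i" if "x \<in> A" "i \<notin> I" for x i
  proof -
    have "x \<notin> coord_hyperplane i" using that by (auto simp: I_def)
    then show ?thesis using nonneg that(1) by (simp add: coord_hyperplane_def less_le)
  qed
  show ?thesis
  proof (cases "I = {}")
    case True
    have "c (toric_domain A) \<le> c (toric_domain ((\<lambda>x. x + ?e) ` A))"
      by (rule capacity_mono[OF capacity symplectically_embeds_toric_translate[where v = ?e]])
        (use pos True in \<open>auto simp: add_pos_pos\<close>)
    moreover have "c (toric_domain ((\<lambda>x. x + ?e) ` A)) \<le> c (toric_domain A)"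
      by (rule capacity_mono[OF capacity symplectically_embeds_toric_translate[where v = "- ?e"]])
        (use pos True in \<open>auto simp: add_pos_pos\<close>)
    ultimately show ?thesis by (rule order_antisym)
  next
    case False
    have low: "lowerable i A" if "i \<in> I" for i
      using criterion_imp_lowerable[of A i] nonneg criterion that compact_imp_closed[OF compact]
      by (simp add: I_def)
    have p: "p \<in> interior A" using star by (simp add: star_center_def)
    have shrink: "p + l *\<^sub>R (x - p) \<in> interior A" if "x \<in> closure (interior A)" "0 \<le> l" "l < 1" for x l
      using shrink_closure_into_interior[OF star hypersurface_gluing_ray_isolated[OF boundary transverse]] that
      by blast
    obtain i where "i \<in> I" using False by blast
    have "topological_hypersurface (frontier A)" using boundary unfolding hypersurface_gluing_def by (elim conjE)
    then have "A = closure (interior A)"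
      using lowerable_eq_closure_interior[OF compact low[OF \<open>i \<in> I\<close>] _ _ p shrink] nonneg by blast
    with shrink have shrink: "p + l *\<^sub>R (x - p) \<in> interior A" if "x \<in> A" "0 \<le> l" "l < 1" for x l
      using that by simp
    show ?thesis
    proof (rule order_antisym)
      show "c (toric_domain ((\<lambda>x. x + ?e) ` A)) \<le> c (toric_domain A)"
      proof (rule ennreal_le_if_smaller_multiples)
        fix l :: real assume l: "0 < l" "l < 1"
        let ?B = "(\<lambda>x. p + l *\<^sub>R (x - p) + 0) ` A"
        have B: "?B \<subseteq> interior A" using shrink l by auto
        have BA: "?B \<subseteq> A" using B interior_subset by blast
        have BA: "?B \<subseteq> A" using B interior_subset by blast
        have BA: "?B \<subseteq> A" using B interior_subset by blast
        have BA: "?B \<subseteq> A" using B interior_subset by blast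
        have BA: "?B \<subseteq> A" using B interior_subset by blast
        have posB: "0 < y $ i" if "y \<in> ?B" for y i
          using interior_nonneg_imp_pos[OF nonneg] B that by blast
        have "ennreal l * c (toric_domain ((\<lambda>x. x + ?e) ` A)) = c (toric_domain ?B)"
          using capacity_toric_dilation[OF capacity l(1) nonneg, of p 0] posB by force
        also have "\<dots> \<le> c (toric_domain A)"
          by (rule capacity_mono[OF capacity symplectically_embeds_toric_translate[where v = 0]])
            (use posB BA in auto)
        finally show "ennreal l * c (toric_domain ((\<lambda>x. x + ?e) ` A)) \<le> c (toric_domain A)" .
      qed
      \<comment> \<open>For \<open>l < b\<close> the translate by 1 of the dilation with factor \<open>l\<close> stays in the open orthant.\<close>
      define b where "b = 1 + 1 / (1 + norm p)"
      have "1 < b" by (simp add: b_def add_pos_nonneg)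
      then show "c (toric_domain A) \<le> c (toric_domain ((\<lambda>x. x + ?e) ` A))"
      proof (rule ennreal_le_if_larger_multiples)
        fix l assume l: "1 < l" "l < b"
        have shrink': "p + (1 / l) *\<^sub>R (x - p) \<in> interior A" if "x \<in> A" for x
          using shrink[OF that] l by simp
        obtain \<epsilon> where \<epsilon>: "0 < \<epsilon>"
          "\<And>x w. x \<in> A \<Longrightarrow>
            \<forall>i. if i \<in> I then 0 \<le> w $ i \<and> w $ i \<le> x $ i + \<epsilon> else w $ i = x $ i \<Longrightarrow>
            w \<in> (\<lambda>x. p + l *\<^sub>R (x - p)) ` A"
          by (rule ex_margin_in_dilation[OF compact low nonneg l(1) shrink']) blast+
        obtain V where V: "symplectically_embeds (toric_domain A) V" "\<And>z i. z \<in> V \<Longrightarrow> z $ i \<noteq> 0"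
          "\<And>z. z \<in> V \<Longrightarrow> \<exists>x\<in>A. (\<forall>i\<in>I. moment_map z $ i \<le> x $ i + \<epsilon>)
            \<and> (\<forall>i. i \<notin> I \<longrightarrow> moment_map z $ i = x $ i)"
          by (rule ex_toric_embedding_off_coordinate_planes[OF compact_imp_bounded[OF compact] \<epsilon>(1) pos]) blast+
        let ?B = "(\<lambda>x. p + l *\<^sub>R (x - p) + ?e) ` A"
        have "symplectically_embeds V (toric_domain ?B)"
        proof (rule symplectically_embeds_translate[where v = ?e])
          fix z i assume z: "z \<in> V"
          show "z $ i \<noteq> 0 \<and> 0 < moment_map z $ i + ?e $ i"
            using V(2)[OF z] by (simp add: moment_map_nth add_nonneg_pos)
        next
          fix z assume "z \<in> V"
          then obtain x where x: "x \<in> A" "\<forall>i\<in>I. moment_map z $ i \<le> x $ i + \<epsilon>"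
            "\<forall>i. i \<notin> I \<longrightarrow> moment_map z $ i = x $ i" using V(3) by blast
          have "moment_map z \<in> (\<lambda>x. p + l *\<^sub>R (x - p)) ` A"
            by (rule \<epsilon>(2)[OF x(1)]) (use x in \<open>auto simp: moment_map_nth\<close>)
          then obtain a where a: "moment_map z = p + l *\<^sub>R (a - p)" "a \<in> A" by (rule imageE)
          show "moment_map z + ?e \<in> ?B" unfolding a(1) using a(2) by (rule imageI)
        qed
        then have "c (toric_domain A) \<le> c (toric_domain ?B)"
          by (rule order_trans[OF capacity_mono[OF capacity V(1)] capacity_mono[OF capacity]])
        also have "\<dots> = ennreal l * c (toric_domain ((\<lambda>x. x + ?e) ` A))"
        proof (rule capacity_toric_dilation[OF capacity _ nonneg])
          fix x i assume x: "x \<in> A"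
          have "(l - 1) * p $ i \<le> (l - 1) * norm p"
            using l component_le_norm_cart[of p i] by (intro mult_left_mono) auto
          also have "\<dots> \<le> (1 / (1 + norm p)) * norm p" using l by (intro mult_right_mono) (auto simp: b_def)
          also have "\<dots> < 1" by (simp add: divide_less_eq add_pos_nonneg)
          finally have "(l - 1) * p $ i < 1" .
          moreover have "0 \<le> l * x $ i" using nonneg x l by simp
          ultimately show "0 < (p + l *\<^sub>R (x - p) + ?e) $ i" by (simp add: algebra_simps)
        qed (use l in simp)
        finally show "c (toric_domain A) \<le> ennreal l * c (toric_domain ((\<lambda>x. x + ?e) ` A))" .
      qed
    qed
  qed
qed

end
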